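(* Let $r$ and $n$ be positive integers such that $(u_{n-1},r)>1$. Set $p:=\langle u_{n-1},r\rangle_\psi$. Then: \begin{enumerate} \item Assume $\psi(p)$ is odd. (a) If $5^{\frac{p-1}{2}}\equiv -1 \pmod p$, then $\mathrm{mincol}_r\, THK(3,n)\le \frac{p+1}{2}$. (b) If $5^{\frac{p-1}{2}}\equiv 1 \pmod p$, then $\mathrm{mincol}_r\, THK(3,n)\le \frac{p-1}{2}$. \item Assume $\psi(p)$ is even. (a) If $4\mid\psi(p)$, then $\mathrm{mincol}_r\, THK(3,n)\le \psi(p)-1$. (b) If $4\nmid\psi(p)$, then $\mathrm{mincol}_r\, THK(3,n)\le \psi(p)-5$. \end{enumerate}
   Context: "Knot" means a knot or link in 3-space. $THK(3,n)$ is the closure of the 3-strand braid $(\sigma_2\sigma_1^{-1})^n\in B_3$. For an integer $r>1$, an $r$-coloring (Fox coloring) of a knot diagram is an assignment of elements of $\mathbb{Z}_r=\mathbb{Z}/r\mathbb{Z}$ to its arcs such that at each crossing $2y-x-z=0$ in $\mathbb{Z}_r$, where $y$ is the color of the over-arc and $x,z$ those of the two under-arcs. It is non-trivial if it uses at least two colors; existence of a non-trivial $r$-coloring does not depend on the diagram. If $K$ admits non-trivial $r$-colorings, let $n_{D,r}$ be the least number of distinct colors used in a non-trivial $r$-coloring of a diagram $D$ of $K$, and set $\mathrm{mincol}_r(K)=\min\{n_{D,r}: D \text{ a diagram of } K\}$. $(a,b)$ denotes the greatest common divisor of the positive integers $a,b$. The integers $u_n$ ($n\ge 0$) are given by \[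 u_n=\frac{1}{\sqrt5}\left[\left(\frac{1+\sqrt5}{2}\right)^{n+2}-\left(\frac{-1+\sqrt5}{2}\right)^{n}-\left(\frac{1-\sqrt5}{2}\right)^{n+2}+\left(\frac{-1-\sqrt5}{2}\right)^{n}\right], \] and for an integer $r>1$, $\psi(r):=\min\{q\in\mathbb{Z}^+ : r\mid u_{q-1}\}$. For any positive integers $n$ and $r$ such that $(u_{n-1},r)>1$, $\langle u_{n-1},r\rangle_\psi$ is defined to be the least common prime factor (greater than $5$) of $r$ and $u_{n-1}$ which minimizes $\psi$.
   Formalization: The formal statement additionally assumes that r and u_{n-1} have a common prime factor greater than 5, since otherwise p is undefined (for example n = 3, r = 2, where u_2 = 4). *)

theory Defs
  imports
    "HOL-Analysis.Analysis"
    "HOL-Library.Extended_Nat"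
    "HOL-Number_Theory.Number_Theory"
begin

section \<open>Links in 3-space and their diagrams\<close>

text \<open>
  Links are subsets of Euclidean 3-space. A diagram is given by a polygonal link in regular
  position with respect to the projection along the third coordinate; the point with the larger
  third coordinate is the over-point of a crossing.
\<close>

type_synonym point3 = "real \<times> real \<times> real"

definition shadow :: "point3 \<Rightarrow> real \<times> real" where
  "shadow = (\<lambda>(x, y, z). (x, y))"

definition height :: "point3 \<Rightarrow> real" where
  "height = (\<lambda>(x, y, z). z)"

definition ambient_isotopic :: "point3 set \<Rightarrow> point3 set \<Rightarrow> bool" where
  "ambient_isotopic K L \<longleftrightarrow>
     (\<exists>h. homotopic_with_canon (\<lambda>f. \<exists>g. homeomorphism UNIV UNIV f g) UNIV UNIV id h \<and> h ` K = L)"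

definition polygonal :: "point3 set \<Rightarrow> bool" where
  "polygonal L \<longleftrightarrow> (\<exists>S. finite S \<and> L = (\<Union>(a, b)\<in>S. closed_segment a b))"

definition straight_at :: "point3 set \<Rightarrow> point3 \<Rightarrow> bool" where
  "straight_at L a \<longleftrightarrow>
     (\<exists>v e. v \<noteq> 0 \<and> e > 0 \<and> L \<inter> ball a e = range (\<lambda>t. a + t *\<^sub>R v) \<inter> ball a e)"

definition multiple_points :: "point3 set \<Rightarrow> (real \<times> real) set" where
  "multiple_points L = {P. \<exists>a\<in>L. \<exists>b\<in>L. a \<noteq> b \<and> shadow a = P \<and> shadow b = P}"

text \<open>
  Finitely many multiple points, all of them double, and no vertex of the polygon lies over a
  double point. Two edges over a double point then cross transversally, since edges with parallel
  shadows would produce infinitely many multiple points.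
\<close>

definition regular_position :: "point3 set \<Rightarrow> bool" where
  "regular_position L \<longleftrightarrow>
     polygonal L \<and>
     finite (multiple_points L) \<and>
     (\<forall>P\<in>multiple_points L. card {a \<in> L. shadow a = P} = 2) \<and>
     (\<forall>a\<in>L. shadow a \<in> multiple_points L \<longrightarrow> straight_at L a)"

text \<open>
  When \<open>K\<close> is a link, so is every \<open>D\<close> ambient isotopic to it; hence no separate requirement
  on \<open>D\<close> is made.
\<close>

definition diagram_of :: "point3 set \<Rightarrow> point3 set \<Rightarrow> bool" where
  "diagram_of D K \<longleftrightarrow> regular_position D \<and> ambient_isotopic K D"


section \<open>Fox colorings\<close>

definition crosses_under :: "point3 set \<Rightarrow> point3 \<Rightarrow> point3 \<Rightarrow> bool" where
  "crosses_under D x y \<longleftrightarrow> x \<in> D \<and> y \<in> D \<and> shadow x = shadow y \<and> height x < height y"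

definition under_points :: "point3 set \<Rightarrow> point3 set" where
  "under_points D = {x. \<exists>y. crosses_under D x y}"

text \<open>The arcs are the pieces into which the link is cut at its under-points.\<close>

definition arcs :: "point3 set \<Rightarrow> point3 set set" where
  "arcs D = components (D - under_points D)"

definition arc_at :: "point3 set \<Rightarrow> point3 \<Rightarrow> point3 set" where
  "arc_at D p = connected_component_set (D - under_points D) p"

text \<open>
  Elements of \<open>\<int>/r\<int>\<close> are represented by \<open>0, \<dots>, r - 1\<close>. The two under-arcs at an
  under-point \<open>x\<close> are those reached by leaving \<open>x\<close> in the directions \<open>v\<close> and
  \<open>-v\<close> along the edge through \<open>x\<close>, before another under-point is met; they may
  coincide.
\<close>

definition fox_coloring :: "nat \<Rightarrow> point3 set \<Rightarrow> (point3 set \<Rightarrow> int) \<Rightarrow> bool" where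
  "fox_coloring r D c \<longleftrightarrow>
     (\<forall>A\<in>arcs D. c A \<in> {0..<int r}) \<and>
     (\<forall>x y. crosses_under D x y \<longrightarrow>
        (\<exists>v. v \<noteq> 0 \<and>
             closed_segment (x - v) (x + v) - {x} \<subseteq> D - under_points D \<and>
             [2 * c (arc_at D y) - c (arc_at D (x - v)) - c (arc_at D (x + v)) = 0] (mod int r)))"

definition num_colors :: "point3 set \<Rightarrow> (point3 set \<Rightarrow> int) \<Rightarrow> nat" where
  "num_colors D c = card (c ` arcs D)"

definition nontrivial_coloring :: "nat \<Rightarrow> point3 set \<Rightarrow> (point3 set \<Rightarrow> int) \<Rightarrow> bool" where
  "nontrivial_coloring r D c \<longleftrightarrow> fox_coloring r D c \<and> num_colors D c \<ge> 2"

text \<open>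
  Both minima take the value \<open>\<infinity>\<close> when there are no non-trivial colorings, so that a finite
  upper bound includes the existence of one.
\<close>

definition diagram_mincol :: "nat \<Rightarrow> point3 set \<Rightarrow> enat" where
  "diagram_mincol r D = (INF c\<in>{c. nontrivial_coloring r D c}. enat (num_colors D c))"

definition mincol :: "nat \<Rightarrow> point3 set \<Rightarrow> enat" where
  "mincol r K = (INF D\<in>{D. diagram_of D K}. diagram_mincol r D)"


section \<open>Closed braids and Turk's head knots\<close>

fun polyline :: "point3 list \<Rightarrow> point3 set" where
  "polyline (p # q # ps) = closed_segment p q \<union> polyline (q # ps)"
| "polyline _ = {}"

text \<open>
  A braid on \<open>s\<close> strands is drawn from left to right, with strand positions at
  \<open>y = 1, \<dots>, s\<close>. It is a word with letters \<open>i\<close> for \<open>\<sigma>\<^sub>i\<close> and \<open>-i\<close> for the inverse of \<open>\<sigma>\<^sub>i\<close>,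
  where \<open>1 \<le> i < s\<close>. In \<open>\<sigma>\<^sub>i\<close> the strand from position \<open>i\<close> to position \<open>i + 1\<close>
  passes over the one from \<open>i + 1\<close> to \<open>i\<close>; in its inverse it passes under. Over-strands
  are raised to level \<open>z = 1\<close> around the crossing and everything else lies in the plane
  \<open>z = 0\<close>.
\<close>

definition flat_strand :: "real \<Rightarrow> real \<Rightarrow> real \<Rightarrow> point3 set" where
  "flat_strand k a b = polyline [(k, a, 0), (k + 1, b, 0)]"

definition over_strand :: "real \<Rightarrow> real \<Rightarrow> real \<Rightarrow> point3 set" where
  "over_strand k a b =
     polyline [(k, a, 0), (k + 1/3, (2 * a + b) / 3, 1), (k + 2/3, (a + 2 * b) / 3, 1), (k + 1, b, 0)]"

definition braid_letter :: "nat \<Rightarrow> real \<Rightarrow> int \<Rightarrow> point3 set" where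
  "braid_letter s k l =
     (let i = nat \<bar>l\<bar> in
       (if l > 0
        then over_strand k (real i) (real (i + 1)) \<union> flat_strand k (real (i + 1)) (real i)
        else over_strand k (real (i + 1)) (real i) \<union> flat_strand k (real i) (real (i + 1))) \<union>
       (\<Union>j\<in>{1..s} - {i, i + 1}. flat_strand k (real j) (real j)))"

text \<open>The closing arcs are nested rectangular arcs running above the braid.\<close>

definition closing_arc :: "nat \<Rightarrow> real \<Rightarrow> nat \<Rightarrow> point3 set" where
  "closing_arc s m j =
     (let y = real j; d = real (s + 1 - j); t = real s + d in
       polyline [(m, y, 0), (m + d, y, 0), (m + d, t, 0), (- d, t, 0), (- d, y, 0), (0, y, 0)])"

definition closed_braid :: "nat \<Rightarrow> int list \<Rightarrow> point3 set" where
  "closed_braid s w =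
     (\<Union>k<length w. braid_letter s (real k) (w ! k)) \<union>
     (\<Union>j\<in>{1..s}. closing_arc s (real (length w)) j)"

definition THK3 :: "nat \<Rightarrow> point3 set" where
  "THK3 n = closed_braid 3 (concat (replicate n [2, -1]))"


section \<open>The arithmetic functions\<close>

definition turk_u_real :: "nat \<Rightarrow> real" where
  "turk_u_real n = 1 / sqrt 5 *
     (((1 + sqrt 5) / 2) ^ (n + 2) - ((-1 + sqrt 5) / 2) ^ n
      - ((1 - sqrt 5) / 2) ^ (n + 2) + ((-1 - sqrt 5) / 2) ^ n)"

definition turk_u :: "nat \<Rightarrow> int" where
  "turk_u n = \<lfloor>turk_u_real n\<rfloor>"

text \<open>The rounding in \<open>turk_u\<close> only changes the type.\<close>

lemma of_int_turk_u: "of_int (turk_u n) = turk_u_real n"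
proof -
  have p: "((-1 + sqrt 5) / 2) ^ n = (-1) ^ n * ((1 - sqrt 5) / 2 :: real) ^ n"
          "((-1 - sqrt 5) / 2) ^ n = (-1) ^ n * ((1 + sqrt 5) / 2 :: real) ^ n"
    by (simp_all flip: power_mult_distrib add: field_simps)
  have f: "real (fib k) = (((1 + sqrt 5) / 2) ^ k - ((1 - sqrt 5) / 2) ^ k) / sqrt 5" for k
    using fib_closed_form[of k] by simp
  have "turk_u_real n = real (fib (n + 2)) + (-1) ^ n * real (fib n)"
    unfolding turk_u_real_def p f by (simp add: field_simps)
  also have "\<dots> = of_int (int (fib (n + 2)) + (-1) ^ n * int (fib n))"
    by simp
  finally show ?thesis
    unfolding turk_u_def by (metis floor_of_int)
qed

definition psi :: "nat \<Rightarrow> nat" where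
  "psi r = (LEAST q. q > 0 \<and> int r dvd turk_u (q - 1))"

definition common_prime :: "int \<Rightarrow> nat \<Rightarrow> nat \<Rightarrow> bool" where
  "common_prime a r q \<longleftrightarrow> prime q \<and> q > 5 \<and> int q dvd a \<and> q dvd r"

text \<open>The least among the primes at which \<open>psi\<close> attains its minimum.\<close>

definition psi_factor :: "int \<Rightarrow> nat \<Rightarrow> nat" where
  "psi_factor a r = (LEAST q. is_arg_min psi (common_prime a r) q)"

end

theory Submission
  imports Defs
begin

text \<open>
  The standard closed braid diagram already carries a colouring with few enough colours.

  In the closure of \<open>(\<sigma>\<^sub>2 \<sigma>\<^sub>1\<^sup>-\<^sup>1)\<^sup>n\<close> the strand in the middle position is the over-strand at
  each of the \<open>2n\<close> crossings, and after a crossing it stays aside at the next one and goes under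
  at the one after that. So if \<open>c (k + 2)\<close> denotes the colour of the over-strand at the \<open>k\<close>th crossing, the
  strands in play there have the colours \<open>c k\<close> (incoming under-strand), \<open>c (k + 1)\<close> (strand that
  does not take part), \<open>c (k + 2)\<close> and \<open>c (k + 3)\<close> (outgoing under-strand). The diagram is
  therefore coloured by every sequence with \<open>c (k + 3) = 2 c (k + 2) - c k\<close> and period \<open>2n\<close>
  (lemma \<open>mincol_THK3_le\<close>). The characteristic polynomial of this recurrence is
  \<open>(x - 1) (x\<^sup>2 - x - 1)\<close>, so all sequences of Fibonacci type satisfy it.

  The number \<open>u\<^sub>n\<^sub>-\<^sub>1\<close> is the Fibonacci number \<open>F\<^sub>n\<close> for even \<open>n\<close> and the Lucas number \<open>L\<^sub>n\<close> for
  odd \<open>n\<close>. If a prime \<open>p\<close> divides it, then every sequence of Fibonacci type has period \<open>2n\<close>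
  modulo \<open>p\<close> (\<open>fib_period\<close>). When \<open>p\<close> divides \<open>r\<close>, multiplication by \<open>r / p\<close> turns such a sequence
  of residues into an \<open>r\<close>-colouring (\<open>mincol_le_fib_recurrence\<close>), and it remains to count
  residues. Let \<open>q = \<psi>(p)\<close>.

  If \<open>q\<close> is odd, then \<open>p\<close> divides \<open>L\<^sub>q\<close>, and from \<open>L\<^sub>q\<^sup>2 - 5 F\<^sub>q\<^sup>2 = -4\<close> it follows that 5 is a
  square modulo \<open>p\<close>; \<open>x\<^sup>2 = x + 1\<close> has a root \<open>\<alpha>\<close> modulo \<open>p\<close>, which can be chosen with
  \<open>\<alpha>\<^sup>q = 1\<close>. The powers of \<open>\<alpha>\<close> form a sequence of Fibonacci type, and as the order of \<open>\<alpha>\<close> is odd and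
  divides \<open>p - 1\<close>, there are at most \<open>(p - 1) / 2\<close> of them. This number serves for both claims about odd \<open>q\<close>.

  If \<open>q\<close> is even, the Fibonacci numbers themselves are used. If \<open>F\<^sub>m\<close> vanishes modulo \<open>p\<close>, then with
  \<open>\<lambda> = F\<^sub>m\<^sub>+\<^sub>1\<close> the sequence satisfies \<open>F\<^sub>m\<^sub>+\<^sub>k = \<lambda> F\<^sub>k\<close> and \<open>F\<^sub>m\<^sub>-\<^sub>k = \<plusminus>\<lambda> F\<^sub>k\<close>, so all of its values
  come from \<open>F\<^sub>0, \<dots>, F\<^sub>m\<^sub>/\<^sub>2\<close> by multiplication with powers of \<open>\<lambda>\<close>
  (\<open>card_fib_residues_le\<close>). The minimality of \<open>q\<close> decides which \<open>m\<close> and \<open>\<lambda>\<close> occur: \<open>m = q\<close> and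
  \<open>\<lambda> = -1\<close> if 4 divides \<open>q\<close>, whereas \<open>m = q / 2\<close> and \<open>\<lambda>\<^sup>2 = -1\<close> otherwise. The values 0 and
  \<open>F\<^sub>1 = F\<^sub>2\<close> account for the last savings.
\<close>

section \<open>Coordinates of the strands\<close>

lemma mem_segment_x:
  fixes x y z :: real
  assumes "x1 < x2"
  shows "(x, y, z) \<in> closed_segment (x1, y1, z1) (x2, y2, z2) \<longleftrightarrow>
    x1 \<le> x \<and> x \<le> x2 \<and> y = y1 + (x - x1) / (x2 - x1) * (y2 - y1) \<and> z = z1 + (x - x1) / (x2 - x1) * (z2 - z1)"
    (is "?L \<longleftrightarrow> ?R")
proof
  assume ?L
  then obtain u where u: "0 \<le> u" "u \<le> 1" and
    e: "x = (1 - u) * x1 + u * x2" "y = (1 - u) * y1 + u * y2" "z = (1 - u) * z1 + u * z2"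
    by (auto simp: in_segment)
  have u': "(x - x1) / (x2 - x1) = u"
    using assms by (simp add: e(1) field_simps)
  have "x \<in> closed_segment x1 x2"
    using u e(1) by (auto simp: in_segment)
  then have "x1 \<le> x" "x \<le> x2"
    using assms by (simp_all add: closed_segment_eq_real_ivl)
  then show ?R
    unfolding u' by (simp add: e(2,3) algebra_simps)
next
  assume R: ?R
  define u where "u = (x - x1) / (x2 - x1)"
  have "0 \<le> u" "u \<le> 1" "x = (1 - u) * x1 + u * x2"
    using R assms by (auto simp: u_def divide_simps) (simp add: algebra_simps)
  moreover have "y = (1 - u) * y1 + u * y2" "z = (1 - u) * z1 + u * z2"
    using R by (auto simp flip: u_def simp add: algebra_simps)
  ultimately show ?L
    by (auto simp: in_segment)
qed

lemma mem_segment_y: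
  fixes x y z :: real
  assumes "y1 < y2"
  shows "(x, y, z) \<in> closed_segment (a, y1, 0) (a, y2, 0) \<longleftrightarrow> x = a \<and> z = 0 \<and> y1 \<le> y \<and> y \<le> y2"
    (is "?L \<longleftrightarrow> ?R")
proof
  assume ?L
  then obtain u where u: "0 \<le> u" "u \<le> 1" and
    e: "x = (1 - u) * a + u * a" "y = (1 - u) * y1 + u * y2" "z = 0"
    by (auto simp: in_segment)
  have "y \<in> closed_segment y1 y2"
    using u e(2) by (auto simp: in_segment)
  then show ?R
    using e assms by (simp add: closed_segment_eq_real_ivl algebra_simps)
next
  assume R: ?R
  define u where "u = (y - y1) / (y2 - y1)"
  have "0 \<le> u" "u \<le> 1" "y = (1 - u) * y1 + u * y2"
    using R assms by (auto simp: u_def divide_simps) (simp add: algebra_simps)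
  with R show ?L
    by (auto simp: in_segment algebra_simps intro!: exI[of _ u])
qed

lemma mem_flat_strand:
  "(x, y, z) \<in> flat_strand k a b \<longleftrightarrow> k \<le> x \<and> x \<le> k + 1 \<and> y = a + (x - k) * (b - a) \<and> z = 0"
  unfolding flat_strand_def by (simp add: mem_segment_x)

lemma mem_over_strand:
  "(x, y, z) \<in> over_strand k a b \<longleftrightarrow>
     k \<le> x \<and> x \<le> k + 1 \<and> y = a + (x - k) * (b - a) \<and> z = min 1 (min (3 * (x - k)) (3 * (k + 1 - x)))"
proof -
  have 1: "(x, y, z) \<in> closed_segment (k, a, 0) (k + 1/3, (2 * a + b) / 3, 1) \<longleftrightarrow>
      k \<le> x \<and> x \<le> k + 1/3 \<and> y = a + (x - k) * (b - a) \<and> z = 3 * (x - k)"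
    by (subst mem_segment_x) (auto simp: field_simps)
  have 2: "(x, y, z) \<in> closed_segment (k + 1/3, (2 * a + b) / 3, 1) (k + 2/3, (a + 2 * b) / 3, 1) \<longleftrightarrow>
      k + 1/3 \<le> x \<and> x \<le> k + 2/3 \<and> y = a + (x - k) * (b - a) \<and> z = 1"
    by (subst mem_segment_x) (auto simp: field_simps)
  have 3: "(x, y, z) \<in> closed_segment (k + 2/3, (a + 2 * b) / 3, 1) (k + 1, b, 0) \<longleftrightarrow>
      k + 2/3 \<le> x \<and> x \<le> k + 1 \<and> y = a + (x - k) * (b - a) \<and> z = 3 * (k + 1 - x)"
    by (subst mem_segment_x) (auto simp: field_simps)
  show ?thesis
    unfolding over_strand_def by (simp add: 1 2 3) (auto simp: min_def)
qed

lemma mem_closing_arc: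
  assumes "1 \<le> j" "j \<le> 3" "0 \<le> m"
  shows "(x, y, z) \<in> closing_arc 3 m j \<longleftrightarrow> z = 0 \<and>
    (y = real j \<and> m \<le> x \<and> x \<le> m + (4 - real j) \<or>
     x = m + (4 - real j) \<and> real j \<le> y \<and> y \<le> 7 - real j \<or>
     y = 7 - real j \<and> - (4 - real j) \<le> x \<and> x \<le> m + (4 - real j) \<or>
     x = - (4 - real j) \<and> real j \<le> y \<and> y \<le> 7 - real j \<or>
     y = real j \<and> - (4 - real j) \<le> x \<and> x \<le> 0)"
proof -
  define d where "d = 4 - real j"
  have d: "0 < d" "real j < 7 - real j" "0 < m + d" "- d < 0" "m < m + d" "- d < m + d"
    using assms by (auto simp: d_def)
  have e: "real (3 + 1 - j) = d" "real 3 + d = 7 - real j"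
    using assms by (auto simp: d_def)
  have 1: "(x, y, z) \<in> closed_segment (m, real j, 0) (m + d, real j, 0) \<longleftrightarrow>
      z = 0 \<and> y = real j \<and> m \<le> x \<and> x \<le> m + d"
    using mem_segment_x[OF d(5), of x y z "real j" 0 "real j" 0] by auto
  have 2: "(x, y, z) \<in> closed_segment (m + d, real j, 0) (m + d, 7 - real j, 0) \<longleftrightarrow>
      z = 0 \<and> x = m + d \<and> real j \<le> y \<and> y \<le> 7 - real j"
    using mem_segment_y[OF d(2), of x y z "m + d"] by auto
  have 3: "(x, y, z) \<in> closed_segment (m + d, 7 - real j, 0) (- d, 7 - real j, 0) \<longleftrightarrow>
      z = 0 \<and> y = 7 - real j \<and> - d \<le> x \<and> x \<le> m + d"
    using mem_segment_x[OF d(6), of x y z "7 - real j" 0 "7 - real j" 0]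
    by (subst closed_segment_commute) auto
  have 4: "(x, y, z) \<in> closed_segment (- d, 7 - real j, 0) (- d, real j, 0) \<longleftrightarrow>
      z = 0 \<and> x = - d \<and> real j \<le> y \<and> y \<le> 7 - real j"
    using mem_segment_y[OF d(2), of x y z "- d"] by (subst closed_segment_commute) auto
  have 5: "(x, y, z) \<in> closed_segment (- d, real j, 0) (0, real j, 0) \<longleftrightarrow>
      z = 0 \<and> y = real j \<and> - d \<le> x \<and> x \<le> 0"
    using mem_segment_x[OF d(4), of x y z "real j" 0 "real j" 0] by auto
  show ?thesis
    unfolding closing_arc_def Let_def e polyline.simps Un_iff 1 2 3 4 5 d_def[symmetric] by blast
qed

section \<open>The standard diagram of the Turk's head link\<close>

text \<open>
  The direction in which the over-strand leaves the middle position at the \<open>k\<close>th crossing: up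
  for the letter 2, down for the letter -1. With this sign both letters share one description.
\<close>

definition side :: "nat \<Rightarrow> real" where
  "side k = (if even k then 1 else -1)"

lemma side_cases: obtains "side k = 1" | "side k = -1"
  by (cases "even k") (auto simp: side_def)

lemma side_le_1: "side k \<le> 1"
  by (simp add: side_def)

lemma side_Suc: "side (Suc k) = - side k"
  by (simp add: side_def)

definition over_piece :: "nat \<Rightarrow> point3 set" where
  "over_piece k = over_strand (real k) 2 (2 + side k)"

definition under_piece :: "nat \<Rightarrow> point3 set" where
  "under_piece k = flat_strand (real k) (2 + side k) 2"

definition idle_piece :: "nat \<Rightarrow> point3 set" where
  "idle_piece k = flat_strand (real k) (2 - side k) (2 - side k)"

lemma length_THK3_word: "length (concat (replicate n [2, -1 :: int])) = 2 * n"
  by (induction n) auto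

lemma nth_THK3_word:
  "k < 2 * n \<Longrightarrow> concat (replicate n [2, -1 :: int]) ! k = (if even k then 2 else -1)"
proof (induction n arbitrary: k)
  case (Suc n)
  show ?case
  proof (cases "k < 2")
    case True
    then have "k = 0 \<or> k = 1" by auto
    then show ?thesis by auto
  next
    case False
    then have k: "k = Suc (Suc (k - 2))" by simp
    have "k - 2 < 2 * n" using Suc.prems False by simp
    then show ?thesis using Suc.IH[of "k - 2"] False by (subst (1 2) k) simp
  qed
qed simp

lemma THK3_letter:
  assumes "k < 2 * n"
  shows "braid_letter 3 (real k) (concat (replicate n [2, -1]) ! k) =
    over_piece k \<union> under_piece k \<union> idle_piece k"
proof -
  have e: "{1..3::nat} - {2, 2 + 1} = {1}" "{1..3::nat} - {1, 1 + 1} = {3}"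
    by (auto simp: atLeastAtMost_def)
  show ?thesis
  proof (cases "even k")
    case True
    have "braid_letter 3 (real k) 2 = over_piece k \<union> under_piece k \<union> idle_piece k"
      using True unfolding braid_letter_def over_piece_def under_piece_def idle_piece_def
      using e(1) by (simp add: Let_def side_def)
    with True assms show ?thesis by (simp add: nth_THK3_word)
  next
    case False
    have "braid_letter 3 (real k) (-1) = over_piece k \<union> under_piece k \<union> idle_piece k"
      using False unfolding braid_letter_def over_piece_def under_piece_def idle_piece_def
      using e(2) by (simp add: Let_def side_def)
    with False assms show ?thesis by (simp add: nth_THK3_word)
  qed
qed

lemma THK3_eq:
  "THK3 n = (\<Union>k<2 * n. over_piece k \<union> under_piece k \<union> idle_piece k) \<union>
     (\<Union>j\<in>{1..3}. closing_arc 3 (real (2 * n)) j)"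
  unfolding THK3_def closed_braid_def length_THK3_word
  using THK3_letter by (intro arg_cong2[where f="(\<union>)"] SUP_cong) auto

lemma mem_over_piece:
  "(x, y, z) \<in> over_piece k \<longleftrightarrow> real k \<le> x \<and> x \<le> real k + 1 \<and> y = 2 + (x - real k) * side k \<and>
     z = min 1 (min (3 * (x - real k)) (3 * (real k + 1 - x)))"
  by (simp add: over_piece_def mem_over_strand)

lemma mem_under_piece:
  "(x, y, z) \<in> under_piece k \<longleftrightarrow> real k \<le> x \<and> x \<le> real k + 1 \<and> y = 2 + (real k + 1 - x) * side k \<and> z = 0"
  by (auto simp add: under_piece_def mem_flat_strand algebra_simps)

lemma mem_idle_piece:
  "(x, y, z) \<in> idle_piece k \<longleftrightarrow> real k \<le> x \<and> x \<le> real k + 1 \<and> y = 2 - side k \<and> z = 0"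
  by (simp add: idle_piece_def mem_flat_strand)

section \<open>Regular position\<close>

lemma polygonal_polyline: "polygonal (polyline ps)"
proof (induction ps rule: polyline.induct)
  case (1 p q ps)
  then obtain S where "finite S" "polyline (q # ps) = (\<Union>(a, b)\<in>S. closed_segment a b)"
    by (auto simp: polygonal_def)
  then show ?case
    unfolding polygonal_def by (intro exI[of _ "insert (p, q) S"]) auto
qed (auto simp: polygonal_def)

lemma polygonal_Un:
  assumes "polygonal A" "polygonal B"
  shows "polygonal (A \<union> B)"
proof -
  from assms obtain S T where "finite S" "A = (\<Union>(a, b)\<in>S. closed_segment a b)"
    "finite T" "B = (\<Union>(a, b)\<in>T. closed_segment a b)"
    by (auto simp: polygonal_def)
  then show ?thesis
    unfolding polygonal_def by (intro exI[of _ "S \<union> T"]) simp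
qed

lemma polygonal_UN:
  assumes "finite I" "\<And>i. i \<in> I \<Longrightarrow> polygonal (A i)"
  shows "polygonal (\<Union>i\<in>I. A i)"
  using assms
proof (induction I rule: finite_induct)
  case empty
  show ?case unfolding polygonal_def by (intro exI[of _ "{}"]) auto
next
  case (insert i I)
  then show ?case by (simp add: polygonal_Un)
qed

lemma polygonal_THK3: "polygonal (THK3 n)"
  unfolding THK3_eq over_piece_def under_piece_def idle_piece_def over_strand_def flat_strand_def
    closing_arc_def Let_def
  by (intro polygonal_Un polygonal_UN polygonal_polyline) auto

lemma closed_polyline: "closed (polyline ps)"
  by (induction ps rule: polyline.induct) auto

definition under_pt :: "nat \<Rightarrow> point3" where
  "under_pt k = (real k + 1/2, 2 + side k / 2, 0)"

definition over_pt :: "nat \<Rightarrow> point3" where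
  "over_pt k = (real k + 1/2, 2 + side k / 2, 1)"

lemma THK3_cases [consumes 1, case_names over under idle closing]:
  assumes "(x, y, z) \<in> THK3 n"
  obtains
    k where "k < 2 * n" "(x, y, z) \<in> over_piece k"
  | k where "k < 2 * n" "(x, y, z) \<in> under_piece k"
  | k where "k < 2 * n" "(x, y, z) \<in> idle_piece k"
  | j where "j \<in> {1..3}" "(x, y, z) \<in> closing_arc 3 (real (2 * n)) j"
  using assms unfolding THK3_eq by blast

text \<open>
  The outer part of each closing arc lies at \<open>y = 7 - j \<ge> 4\<close>, above all crossings of the braid.
\<close>

lemma closing_arc_outside:
  assumes "(x, y, z) \<in> closing_arc 3 (real (2 * n)) j" "j \<in> {1..3}"
  shows "z = 0" "x \<le> 0 \<or> real (2 * n) \<le> x \<or> 4 \<le> y"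
  using assms by (auto simp: mem_closing_arc)

lemma unit_interval_unique:
  assumes "real k < x" "x < real k + 1" "real l \<le> x" "x \<le> real l + 1"
  shows "l = k"
  using assms by linarith

text \<open>
  Over the interior of the \<open>k\<close>th unit interval, only the \<open>k\<close>th letter lies below the closing arcs.
  This localises every question about a crossing to the three strands of one letter.
\<close>

lemma THK3_over_unit_interval:
  assumes "(x, y, z) \<in> THK3 n" "real k < x" "x < real k + 1" "k < 2 * n" "y < 4"
  shows "(x, y, z) \<in> over_piece k \<union> under_piece k \<union> idle_piece k"
  using assms(1)
proof (cases rule: THK3_cases)
  case (over l)
  then have "l = k" using assms by (intro unit_interval_unique[of k x]) (auto simp: mem_over_piece)
  then show ?thesis using over by auto
next
  case (under l)
  then have "l = k" using assms by (intro unit_interval_unique[of k x]) (auto simp: mem_under_piece)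
  then show ?thesis using under by auto
next
  case (idle l)
  then have "l = k" using assms by (intro unit_interval_unique[of k x]) (auto simp: mem_idle_piece)
  then show ?thesis using idle by auto
next
  case (closing j)
  from closing_arc_outside(2)[OF closing(2,1)] assms show ?thesis by auto
qed

text \<open>
  The higher point has positive height, so it is interior to an over-strand; the point below it then
  belongs to the same letter, and linear arithmetic leaves only the middle of the under-strand.
\<close>

lemma crosses_under_THK3:
  assumes "crosses_under (THK3 n) a b"
  obtains k where "k < 2 * n" "a = under_pt k" "b = over_pt k"
proof -
  obtain x y z z' where a: "a = (x, y, z)" and b: "b = (x, y, z')"
    and D: "(x, y, z) \<in> THK3 n" "(x, y, z') \<in> THK3 n" and z: "z < z'"
    using assms by (cases a; cases b) (auto simp: crosses_under_def shadow_def height_def)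
  have "z \<ge> 0"
    using D(1)
  proof (cases rule: THK3_cases)
    case (closing j)
    then show ?thesis using closing_arc_outside(1) by fastforce
  qed (auto simp: mem_over_piece mem_under_piece mem_idle_piece)
  have "\<exists>k<2*n. (x, y, z') \<in> over_piece k"
    using D(2)
  proof (cases rule: THK3_cases)
    case (closing j)
    then show ?thesis using closing_arc_outside(1) z \<open>z \<ge> 0\<close> by fastforce
  qed (use z \<open>z \<ge> 0\<close> in \<open>auto simp: mem_under_piece mem_idle_piece\<close>)
  then obtain k where k: "k < 2 * n" and o: "(x, y, z') \<in> over_piece k" by auto
  have x: "real k < x" "x < real k + 1" and y: "y = 2 + (x - real k) * side k"
    using o z \<open>z \<ge> 0\<close> by (auto simp: mem_over_piece)
  have y4: "y < 4" using x y by (cases rule: side_cases[of k]) auto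
  have "(x, y, z) \<in> over_piece k \<union> under_piece k \<union> idle_piece k"
    by (rule THK3_over_unit_interval[OF D(1) x k y4])
  moreover have "(x, y, z) \<notin> over_piece k"
    using o z by (auto simp: mem_over_piece)
  moreover have "(x, y, z) \<notin> idle_piece k"
    using x y by (cases rule: side_cases[of k]) (auto simp: mem_idle_piece)
  ultimately have u: "(x, y, z) \<in> under_piece k" by blast
  then have "x = real k + 1/2"
    using y by (cases rule: side_cases[of k]) (auto simp: mem_under_piece)
  with u o have "a = under_pt k" "b = over_pt k"
    unfolding a b under_pt_def over_pt_def by (auto simp: mem_under_piece mem_over_piece)
  with k that show thesis by blast
qed

lemma pts_in_pieces: "under_pt k \<in> under_piece k" "over_pt k \<in> over_piece k"
  by (auto simp: under_pt_def over_pt_def mem_under_piece mem_over_piece)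

lemma crosses_under_THK3_pt:
  assumes "k < 2 * n"
  shows "crosses_under (THK3 n) (under_pt k) (over_pt k)"
proof -
  have "under_pt k \<in> THK3 n" "over_pt k \<in> THK3 n"
    using assms pts_in_pieces[of k] unfolding THK3_eq by auto
  then show ?thesis
    by (simp add: crosses_under_def under_pt_def over_pt_def shadow_def height_def)
qed

lemma under_points_THK3: "under_points (THK3 n) = under_pt ` {..<2 * n}"
  unfolding under_points_def by (blast elim: crosses_under_THK3 intro: crosses_under_THK3_pt)

lemma same_shadow_crosses:
  assumes "a \<in> D" "b \<in> D" "a \<noteq> b" "shadow a = shadow b"
  shows "crosses_under D a b \<or> crosses_under D b a"
  using assms
  by (cases a; cases b) (auto simp: crosses_under_def shadow_def height_def)

lemma shadow_over_pt: "shadow (over_pt k) = shadow (under_pt k)"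
  by (simp add: under_pt_def over_pt_def shadow_def)

lemma shadow_under_pt_eq: "shadow (under_pt k) = shadow (under_pt l) \<longleftrightarrow> k = l"
  by (auto simp: under_pt_def shadow_def)

lemma under_pt_neq_over_pt: "under_pt k \<noteq> over_pt l"
  by (simp add: under_pt_def over_pt_def)

lemma multiple_points_THK3: "multiple_points (THK3 n) = (\<lambda>k. shadow (under_pt k)) ` {..<2 * n}"
proof (intro equalityI subsetI)
  fix P assume "P \<in> multiple_points (THK3 n)"
  then obtain a b where ab: "a \<in> THK3 n" "b \<in> THK3 n" "a \<noteq> b" "shadow a = P" "shadow b = P"
    unfolding multiple_points_def by blast
  then have "crosses_under (THK3 n) a b \<or> crosses_under (THK3 n) b a"
    by (intro same_shadow_crosses) auto
  then show "P \<in> (\<lambda>k. shadow (under_pt k)) ` {..<2 * n}"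
    using ab by (auto elim!: crosses_under_THK3 simp: shadow_over_pt)
next
  fix P assume "P \<in> (\<lambda>k. shadow (under_pt k)) ` {..<2 * n}"
  then obtain k where k: "k < 2 * n" "P = shadow (under_pt k)" by auto
  from crosses_under_THK3_pt[OF k(1)] have "under_pt k \<in> THK3 n" "over_pt k \<in> THK3 n"
    by (simp_all add: crosses_under_def)
  then show "P \<in> multiple_points (THK3 n)"
    unfolding multiple_points_def k(2) using shadow_over_pt under_pt_neq_over_pt by blast
qed

lemma fibre_THK3:
  assumes k: "k < 2 * n"
  shows "{a \<in> THK3 n. shadow a = shadow (under_pt k)} = {under_pt k, over_pt k}"
proof (intro equalityI subsetI)
  fix a assume a: "a \<in> {a \<in> THK3 n. shadow a = shadow (under_pt k)}"
  have U: "under_pt k \<in> THK3 n"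
    using crosses_under_THK3_pt[OF k] by (simp add: crosses_under_def)
  show "a \<in> {under_pt k, over_pt k}"
  proof (cases "a = under_pt k")
    case False
    with a U have "crosses_under (THK3 n) a (under_pt k) \<or> crosses_under (THK3 n) (under_pt k) a"
      by (intro same_shadow_crosses) auto
    then obtain l where "a = over_pt l" "under_pt k = under_pt l"
      by (metis crosses_under_THK3 under_pt_neq_over_pt)
    then have "a = over_pt k"
      by (metis shadow_under_pt_eq)
    then show ?thesis by simp
  qed auto
next
  fix a assume "a \<in> {under_pt k, over_pt k}"
  then show "a \<in> {a \<in> THK3 n. shadow a = shadow (under_pt k)}"
    using crosses_under_THK3_pt[OF k] shadow_over_pt[of k] by (auto simp: crosses_under_def)
qed

lemma dist_triple_less:
  fixes a b c :: real
  assumes "dist (a, b, c) (x, y, z) < e"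
  shows "\<bar>x - a\<bar> < e" "\<bar>y - b\<bar> < e" "\<bar>z - c\<bar> < e"
proof -
  have "dist a x \<le> dist (a, b, c) (x, y, z)" "dist (b, c) (y, z) \<le> dist (a, b, c) (x, y, z)"
    using dist_fst_le[of "(a, b, c)" "(x, y, z)"] dist_snd_le[of "(a, b, c)" "(x, y, z)"] by simp_all
  moreover have "dist b y \<le> dist (b, c) (y, z)" "dist c z \<le> dist (b, c) (y, z)"
    using dist_fst_le[of "(b, c)" "(y, z)"] dist_snd_le[of "(b, c)" "(y, z)"] by simp_all
  ultimately show "\<bar>x - a\<bar> < e" "\<bar>y - b\<bar> < e" "\<bar>z - c\<bar> < e"
    using assms by (simp_all add: dist_real_def)
qed

text \<open>
  The radius \<open>1/8\<close> keeps within the middle third of the unit interval, where the over-strand is level.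
\<close>

lemma over_piece_level:
  assumes "(x, y, z) \<in> over_piece k" "\<bar>x - (real k + 1/2)\<bar> < 1/8"
  shows "z = 1"
proof -
  have "real k + 3/8 < x" "x < real k + 5/8"
    using assms(2) unfolding abs_diff_less_iff by auto
  then have "1 \<le> 3 * (x - real k)" "1 \<le> 3 * (real k + 1 - x)"
    by (simp_all add: algebra_simps)
  with assms(1) show ?thesis
    by (simp add: mem_over_piece)
qed

text \<open>
  In a ball of radius \<open>1/8\<close> around the crossing point only the under-strand remains: the over-strand
  is at height 1 there, and the idle strand is at horizontal distance \<open>3/2\<close>.
\<close>

lemma straight_at_under_pt:
  assumes k: "k < 2 * n"
  shows "straight_at (THK3 n) (under_pt k)"
  unfolding straight_at_def
proof (intro exI conjI)
  let ?v = "(1, - side k, 0) :: point3"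
  show "THK3 n \<inter> ball (under_pt k) (1/8) = range (\<lambda>t. under_pt k + t *\<^sub>R ?v) \<inter> ball (under_pt k) (1/8)"
  proof (intro equalityI subsetI)
    fix P assume P: "P \<in> THK3 n \<inter> ball (under_pt k) (1/8)"
    obtain x y z where xyz: "P = (x, y, z)" by (cases P)
    have near: "\<bar>x - (real k + 1/2)\<bar> < 1/8" "\<bar>y - (2 + side k / 2)\<bar> < 1/8" "\<bar>z\<bar> < 1/8"
      using P dist_triple_less[of "real k + 1/2" "2 + side k / 2" 0 x y z "1/8"]
      by (auto simp: xyz under_pt_def)
    have "real k < x" "x < real k + 1" "y < 4"
      using near side_le_1[of k] by linarith+
    with P k have "(x, y, z) \<in> over_piece k \<union> under_piece k \<union> idle_piece k"
      by (intro THK3_over_unit_interval) (simp_all add: xyz)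
    moreover have "(x, y, z) \<notin> over_piece k"
      using near over_piece_level[of x y z k] by auto
    moreover have "(x, y, z) \<notin> idle_piece k"
      using near by (cases rule: side_cases[of k]) (auto simp: mem_idle_piece)
    ultimately have "y = 2 + (real k + 1 - x) * side k" "z = 0"
      by (auto simp: mem_under_piece)
    then have "P = under_pt k + (x - (real k + 1/2)) *\<^sub>R ?v"
      by (simp add: xyz under_pt_def algebra_simps)
    with P show "P \<in> range (\<lambda>t. under_pt k + t *\<^sub>R ?v) \<inter> ball (under_pt k) (1/8)"
      by blast
  next
    fix P assume P: "P \<in> range (\<lambda>t. under_pt k + t *\<^sub>R ?v) \<inter> ball (under_pt k) (1/8)"
    then obtain t where t: "P = under_pt k + t *\<^sub>R ?v" by auto
    have "\<bar>t\<bar> < 1/8"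
      using P dist_triple_less(1)[of "real k + 1/2" "2 + side k / 2" 0
          "real k + 1/2 + t" "2 + side k / 2 - t * side k" 0 "1/8"]
      by (auto simp: t under_pt_def)
    then have "P \<in> under_piece k"
      by (auto simp: t under_pt_def mem_under_piece algebra_simps)
    with P k show "P \<in> THK3 n \<inter> ball (under_pt k) (1/8)"
      unfolding THK3_eq by blast
  qed
qed (simp_all add: zero_prod_def)

lemma straight_at_over_pt:
  assumes k: "k < 2 * n"
  shows "straight_at (THK3 n) (over_pt k)"
  unfolding straight_at_def
proof (intro exI conjI)
  let ?v = "(1, side k, 0) :: point3"
  show "THK3 n \<inter> ball (over_pt k) (1/8) = range (\<lambda>t. over_pt k + t *\<^sub>R ?v) \<inter> ball (over_pt k) (1/8)"
  proof (intro equalityI subsetI)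
    fix P assume P: "P \<in> THK3 n \<inter> ball (over_pt k) (1/8)"
    obtain x y z where xyz: "P = (x, y, z)" by (cases P)
    have near: "\<bar>x - (real k + 1/2)\<bar> < 1/8" "\<bar>y - (2 + side k / 2)\<bar> < 1/8" "\<bar>z - 1\<bar> < 1/8"
      using P dist_triple_less[of "real k + 1/2" "2 + side k / 2" 1 x y z "1/8"]
      by (auto simp: xyz over_pt_def)
    have "real k < x" "x < real k + 1" "y < 4"
      using near side_le_1[of k] by linarith+
    with P k have "(x, y, z) \<in> over_piece k \<union> under_piece k \<union> idle_piece k"
      by (intro THK3_over_unit_interval) (simp_all add: xyz)
    moreover have "(x, y, z) \<notin> under_piece k" "(x, y, z) \<notin> idle_piece k"
      using near by (auto simp: mem_under_piece mem_idle_piece)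
    ultimately have "(x, y, z) \<in> over_piece k" by blast
    then have "y = 2 + (x - real k) * side k" "z = 1"
      using near over_piece_level[of x y z k] by (auto simp: mem_over_piece)
    then have "P = over_pt k + (x - (real k + 1/2)) *\<^sub>R ?v"
      by (simp add: xyz over_pt_def algebra_simps)
    with P show "P \<in> range (\<lambda>t. over_pt k + t *\<^sub>R ?v) \<inter> ball (over_pt k) (1/8)"
      by blast
  next
    fix P assume P: "P \<in> range (\<lambda>t. over_pt k + t *\<^sub>R ?v) \<inter> ball (over_pt k) (1/8)"
    then obtain t where t: "P = over_pt k + t *\<^sub>R ?v" by auto
    have "\<bar>t\<bar> < 1/8"
      using P dist_triple_less(1)[of "real k + 1/2" "2 + side k / 2" 1
          "real k + 1/2 + t" "2 + side k / 2 + t * side k" 1 "1/8"]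
      by (auto simp: t over_pt_def)
    then have "P \<in> over_piece k"
      by (auto simp: t over_pt_def mem_over_piece algebra_simps)
    with P k show "P \<in> THK3 n \<inter> ball (over_pt k) (1/8)"
      unfolding THK3_eq by blast
  qed
qed (simp_all add: zero_prod_def)

lemma regular_position_THK3: "regular_position (THK3 n)"
  unfolding regular_position_def
proof (intro conjI ballI impI)
  show "polygonal (THK3 n)" by (rule polygonal_THK3)
  show "finite (multiple_points (THK3 n))" by (simp add: multiple_points_THK3)
next
  fix P assume "P \<in> multiple_points (THK3 n)"
  then obtain k where "k < 2 * n" "P = shadow (under_pt k)"
    by (auto simp: multiple_points_THK3)
  then show "card {a \<in> THK3 n. shadow a = P} = 2"
    by (simp add: fibre_THK3 under_pt_neq_over_pt)
next
  fix a assume a: "a \<in> THK3 n" "shadow a \<in> multiple_points (THK3 n)"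
  then obtain k where k: "k < 2 * n" "shadow a = shadow (under_pt k)"
    by (auto simp: multiple_points_THK3)
  with a fibre_THK3[OF k(1)] have "a = under_pt k \<or> a = over_pt k" by blast
  with k straight_at_under_pt straight_at_over_pt show "straight_at (THK3 n) a" by blast
qed

text \<open>The constant isotopy.\<close>

lemma diagram_of_THK3: "diagram_of (THK3 n) (THK3 n)"
proof -
  have "homotopic_with_canon (\<lambda>f. \<exists>g. homeomorphism UNIV UNIV f g) UNIV UNIV id (id :: point3 \<Rightarrow> point3)"
    by (auto simp: homotopic_with_refl homeomorphism_def intro!: exI[of _ id])
  then show ?thesis
    using regular_position_THK3 unfolding diagram_of_def ambient_isotopic_def by (metis image_id id_apply)
qed

section \<open>Colours of the strands\<close>

text \<open>
  The strands of a letter, with the under-strand cut in two at the crossing, each paired with the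
  index of its colour in the colour sequence. The indices are chosen such that strands of
  consecutive letters carry the same index where they meet.
\<close>

definition letter_pieces :: "nat \<Rightarrow> (point3 set \<times> nat) set" where
  "letter_pieces k =
     {(under_piece k \<inter> {P. fst P \<le> real k + 1/2}, k), (idle_piece k, k + 1),
      (over_piece k, k + 2), (under_piece k \<inter> {P. fst P \<ge> real k + 1/2}, k + 3)}"

text \<open>
  The closing arc at position \<open>j\<close> continues the strand with colour index \<open>j mod 3\<close> at the left end
  (positions 1, 2, 3 carry the indices 1, 2, 0) and \<open>j mod 3 + 2n\<close> at the right end.
\<close>

definition indexed_pieces :: "nat \<Rightarrow> (point3 set \<times> nat) set" where
  "indexed_pieces n =
     (\<Union>k<2 * n. letter_pieces k) \<union> (\<lambda>j. (closing_arc 3 (real (2 * n)) j, j mod 3)) ` {1..3}"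

lemma indexed_pieces_cases [consumes 1, case_names letter closing]:
  assumes "(A, i) \<in> indexed_pieces n"
  obtains k where "k < 2 * n" "(A, i) \<in> letter_pieces k"
  | j where "j \<in> {1..3}" "A = closing_arc 3 (real (2 * n)) j" "i = j mod 3"
  using assms unfolding indexed_pieces_def by blast

lemma finite_indexed_pieces: "finite (indexed_pieces n)"
  by (simp add: indexed_pieces_def letter_pieces_def)

lemma closed_indexed_piece:
  assumes "(A, i) \<in> indexed_pieces n"
  shows "closed A"
proof -
  have "closed (over_piece k)" "closed (under_piece k)" "closed (idle_piece k)"
    "closed (closing_arc 3 m j)" for k m j
    unfolding over_piece_def under_piece_def idle_piece_def over_strand_def flat_strand_def
      closing_arc_def Let_def by (rule closed_polyline)+
  moreover have "closed {P :: point3. fst P \<le> c}" "closed {P :: point3. fst P \<ge> c}" for c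
    by (intro closed_Collect_le continuous_intros)+
  ultimately have closed: "closed (over_piece k)" "closed (idle_piece k)" "closed (closing_arc 3 m j)"
    "closed (under_piece k \<inter> {P. fst P \<le> d})" "closed (under_piece k \<inter> {P. fst P \<ge> d})" for k m j d
    by (simp_all add: closed_Int)
  show ?thesis
    using assms
  proof (cases rule: indexed_pieces_cases)
    case (letter k)
    then show ?thesis unfolding letter_pieces_def using closed by blast
  next
    case (closing j)
    then show ?thesis using closed by simp
  qed
qed

lemma Union_indexed_pieces: "\<Union> (fst ` indexed_pieces n) = THK3 n"
proof -
  have 1: "\<Union> (fst ` letter_pieces k) = over_piece k \<union> under_piece k \<union> idle_piece k" for k
    by (auto simp: letter_pieces_def)
  have "\<Union> (fst ` indexed_pieces n) =
      (\<Union>k<2 * n. \<Union> (fst ` letter_pieces k)) \<union> (\<Union>j\<in>{1..3}. closing_arc 3 (real (2 * n)) j)"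
    unfolding indexed_pieces_def by force
  then show ?thesis
    unfolding THK3_eq 1 .
qed

lemma mem_letter_piece:
  assumes "(A, i) \<in> letter_pieces k" "(x, y, z) \<in> A"
  shows "real k \<le> x" "x \<le> real k + 1"
    "i = k \<and> y = 2 + (real k + 1 - x) * side k \<and> z = 0 \<and> x \<le> real k + 1/2 \<or>
     i = k + 1 \<and> y = 2 - side k \<or>
     i = k + 2 \<and> y = 2 + (x - real k) * side k \<and> (x = real k + 1/2 \<longrightarrow> z = 1) \<or>
     i = k + 3 \<and> y = 2 + (real k + 1 - x) * side k \<and> z = 0 \<and> real k + 1/2 \<le> x" (is ?coords)
proof -
  consider "i = k" "(x, y, z) \<in> under_piece k" "x \<le> real k + 1/2"
    | "i = k + 1" "(x, y, z) \<in> idle_piece k"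
    | "i = k + 2" "(x, y, z) \<in> over_piece k"
    | "i = k + 3" "(x, y, z) \<in> under_piece k" "real k + 1/2 \<le> x"
    using assms unfolding letter_pieces_def by fastforce
  then have "real k \<le> x \<and> x \<le> real k + 1 \<and> ?coords"
  proof cases
    case 3
    then have "x = real k + 1/2 \<longrightarrow> z = 1" by (simp add: mem_over_piece)
    with 3 show ?thesis by (simp add: mem_over_piece)
  qed (simp_all add: mem_under_piece mem_idle_piece)
  then show "real k \<le> x" "x \<le> real k + 1" ?coords by blast+
qed

lemma same_letter_index:
  assumes "(A, i) \<in> letter_pieces k" "(B, j) \<in> letter_pieces k" "P \<in> A" "P \<in> B" "P \<noteq> under_pt k"
  shows "i = j"
proof -
  obtain x y z where P: "P = (x, y, z)" by (cases P)
  have *: "(x, y, z) \<noteq> under_pt k" using assms(5) P by simp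
  note mem = mem_letter_piece[OF assms(1) assms(3)[unfolded P]]
    mem_letter_piece[OF assms(2) assms(4)[unfolded P]]
  \<comment> \<open>The idle strand stays on the side that the two crossing strands do not visit.\<close>
  have idle: "y \<noteq> 2 - side k" if "y = 2 + (real k + 1 - x) * side k \<or> y = 2 + (x - real k) * side k"
    using that mem(1,2) by (cases rule: side_cases[of k]) auto
  have cross: "x = real k + 1/2" if "y = 2 + (real k + 1 - x) * side k" "y = 2 + (x - real k) * side k"
    using that by (cases rule: side_cases[of k]) auto
  have cut: "\<not> (x \<le> real k + 1/2 \<and> real k + 1/2 \<le> x)"
    if "y = 2 + (real k + 1 - x) * side k" "z = 0"
  proof
    assume "x \<le> real k + 1/2 \<and> real k + 1/2 \<le> x"
    then have "x = real k + 1/2" by simp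
    then show False using * that by (simp add: under_pt_def)
  qed
  show ?thesis
    using mem(3,6) idle cross cut zero_neq_one by metis
qed

text \<open>
  At \<open>x = k + 1\<close> the letters meet in the three positions \<open>2 - s\<close>, \<open>2 + s\<close> and 2, where \<open>s = side k\<close>; on
  both sides these carry the indices \<open>k + 1\<close>, \<open>k + 2\<close> and \<open>k + 3\<close>.
\<close>

lemma next_letter_index:
  assumes "(A, i) \<in> letter_pieces k" "(B, j) \<in> letter_pieces (Suc k)" "P \<in> A" "P \<in> B"
  shows "i = j"
proof -
  obtain x y z where P: "P = (x, y, z)" by (cases P)
  note mem = mem_letter_piece[OF assms(1) assms(3)[unfolded P]]
    mem_letter_piece[OF assms(2) assms(4)[unfolded P]]
  have x: "x = real k + 1" using mem by simp
  have "i = k + 1 \<and> y = 2 - side k \<or> i = k + 2 \<and> y = 2 + side k \<or> i = k + 3 \<and> y = 2"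
    using mem(3) by (auto simp: x)
  moreover have "j = k + 1 \<and> y = 2 - side k \<or> j = k + 2 \<and> y = 2 + side k \<or> j = k + 3 \<and> y = 2"
    using mem(6) by (auto simp: x side_Suc)
  moreover have "side k \<noteq> 0" by (simp add: side_def)
  ultimately show ?thesis by auto
qed

text \<open>
  The \<open>j\<close>th closing arc lies on the boundary of the \<open>j\<close>th of a family of nested rectangles, which
  are the level sets of this function. Hence different closing arcs are disjoint.
\<close>

lemma closing_arc_level:
  assumes "(x, y, z) \<in> closing_arc 3 m j" "j \<in> {1..3}" "0 \<le> m"
  shows "min (min (x + 4) (m + 4 - x)) (min y (7 - y)) = real j"
proof -
  have j: "1 \<le> real j" "real j \<le> 3" using assms(2) by auto
  consider "y = real j" "m \<le> x" "x \<le> m + (4 - real j)"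
    | "x = m + (4 - real j)" "real j \<le> y" "y \<le> 7 - real j"
    | "y = 7 - real j" "- (4 - real j) \<le> x" "x \<le> m + (4 - real j)"
    | "x = - (4 - real j)" "real j \<le> y" "y \<le> 7 - real j"
    | "y = real j" "- (4 - real j) \<le> x" "x \<le> 0"
    using assms mem_closing_arc[of j m x y z] by auto
  then show ?thesis
    using j assms(3) by cases (simp_all add: min_def)
qed

lemma closing_arc_index:
  assumes "j \<in> {1..3}" "j' \<in> {1..3}"
    and "P \<in> closing_arc 3 (real m) j" "P \<in> closing_arc 3 (real m) j'"
  shows "j = j'"
proof -
  obtain x y z where P: "P = (x, y, z)" by (cases P)
  then have "real j = real j'"
    using closing_arc_level[of x y z "real m"] assms by (metis of_nat_0_le_iff)
  then show ?thesis by simp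
qed

text \<open>
  The braid has \<open>y \<le> 3\<close>, so it meets a closing arc only on the horizontal pieces of the arc at
  \<open>y = j\<close>, that is, at the left end of the first letter or the right end of the last one.
\<close>

lemma letter_closing_index:
  assumes "(A, i) \<in> letter_pieces k" "k < 2 * n" "P \<in> A"
    and "P \<in> closing_arc 3 (real (2 * n)) j" "j \<in> {1..3}"
  shows "i = j mod 3 \<or> i = j mod 3 + 2 * n"
proof -
  obtain x y z where P: "P = (x, y, z)" by (cases P)
  note mem = mem_letter_piece[OF assms(1) assms(3)[unfolded P]]
  have y3: "y \<le> 3"
  proof -
    have "(real k + 1 - x) * side k \<le> 1" "(x - real k) * side k \<le> 1" "- side k \<le> 1"
      using mem(1,2) by (cases rule: side_cases[of k]; simp)+
    then show ?thesis using mem(3) by auto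
  qed
  have j: "j = 1 \<or> j = 2 \<or> j = 3" using assms(5) by auto
  have kn: "real k + 1 \<le> real (2 * n)" using assms(2) by linarith
  have c: "(x \<le> 0 \<or> real (2 * n) \<le> x) \<and> y = real j"
  proof -
    have "1 \<le> real j" "real j \<le> 3" "0 \<le> real k" using j by auto
    then show ?thesis
      using assms(4,5) mem_closing_arc[of j "real (2 * n)" x y z] y3 kn mem(1,2)
      unfolding P by (smt (verit) atLeastAtMost_iff of_nat_0_le_iff)
  qed
  then consider "k = 0" "x = 0" | "Suc k = 2 * n" "x = real k + 1"
    using mem(1,2) kn by linarith
  then show ?thesis
  proof cases
    case 1
    then show ?thesis using mem(3) c j by (auto simp: side_def)
  next
    case 2
    then have "odd k" by presburger
    then have "side k = -1" by (simp add: side_def)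
    then show ?thesis using mem(3) c j 2 by auto
  qed
qed

lemma overlap_index:
  assumes per: "\<And>k. c (k + 2 * n) = c k"
    and A: "(A, i) \<in> indexed_pieces n" "P \<in> A" and B: "(B, j) \<in> indexed_pieces n" "P \<in> B"
    and U: "P \<notin> under_points (THK3 n)"
  shows "c i = c j"
  using A(1)
proof (cases rule: indexed_pieces_cases)
  case k: (letter k)
  show ?thesis
    using B(1)
  proof (cases rule: indexed_pieces_cases)
    case l: (letter l)
    obtain x y z where P: "P = (x, y, z)" by (cases P)
    have "real k \<le> x" "x \<le> real k + 1" "real l \<le> x" "x \<le> real l + 1"
      using mem_letter_piece(1,2)[OF k(2) A(2)[unfolded P]]
        mem_letter_piece(1,2)[OF l(2) B(2)[unfolded P]] by auto
    then have "l = k \<or> l = Suc k \<or> k = Suc l" by linarith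
    moreover have "P \<noteq> under_pt k" using U k(1) by (auto simp: under_points_THK3)
    ultimately have "i = j"
      using same_letter_index next_letter_index k l A(2) B(2) by metis
    then show ?thesis by simp
  next
    case l: (closing l)
    then show ?thesis
      using letter_closing_index[OF k(2,1) A(2), of l] B(2) per by auto
  qed
next
  case k: (closing k)
  show ?thesis
    using B(1)
  proof (cases rule: indexed_pieces_cases)
    case l: (letter l)
    then show ?thesis
      using letter_closing_index[OF l(2,1) B(2), of k] k A(2) per by auto
  next
    case l: (closing l)
    then show ?thesis
      using closing_arc_index[OF k(1) l(1), of P "2 * n"] k A(2) B(2) by auto
  qed
qed

text \<open>
  A labelling of finitely many closed pieces that is consistent off \<open>U\<close> is constant on connected
  sets that avoid \<open>U\<close>: the pieces with a given label and those with another one form two closed sets that are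
  disjoint off \<open>U\<close>.
\<close>

lemma colouring_from_pieces:
  fixes Q :: "('a :: topological_space set \<times> 'i) set" and c :: "'i \<Rightarrow> 'c"
  assumes fin: "finite Q" and cl: "\<And>A i. (A, i) \<in> Q \<Longrightarrow> closed A"
    and overlap: "\<And>A i B j P. (A, i) \<in> Q \<Longrightarrow> P \<in> A \<Longrightarrow> (B, j) \<in> Q \<Longrightarrow> P \<in> B \<Longrightarrow> P \<notin> U \<Longrightarrow> c i = c j"
  obtains f where "\<And>A i P. (A, i) \<in> Q \<Longrightarrow> P \<in> A \<Longrightarrow> P \<notin> U \<Longrightarrow> f P = c i"
    and "\<And>C P P'. connected C \<Longrightarrow> C \<subseteq> \<Union> (fst ` Q) - U \<Longrightarrow> P \<in> C \<Longrightarrow> P' \<in> C \<Longrightarrow> f P = f P'"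
proof
  define f where "f P = c (SOME i. \<exists>A. (A, i) \<in> Q \<and> P \<in> A)" for P
  show f: "f P = c i" if "(A, i) \<in> Q" "P \<in> A" "P \<notin> U" for A i P
  proof -
    have "\<exists>A. (A, SOME i. \<exists>A. (A, i) \<in> Q \<and> P \<in> A) \<in> Q \<and> P \<in> A"
      by (rule someI[of "\<lambda>i. \<exists>A. (A, i) \<in> Q \<and> P \<in> A" i]) (use that in blast)
    then show ?thesis
      unfolding f_def using overlap that by blast
  qed
  show "f P = f P'" if C: "connected C" "C \<subseteq> \<Union> (fst ` Q) - U" and P: "P \<in> C" "P' \<in> C" for C P P'
  proof (rule ccontr)
    assume neq: "f P \<noteq> f P'"
    define K where "K = \<Union> {A. \<exists>i. (A, i) \<in> Q \<and> c i = f P}"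
    define L where "L = \<Union> {A. \<exists>i. (A, i) \<in> Q \<and> c i \<noteq> f P}"
    have "{A. \<exists>i. (A, i) \<in> Q \<and> c i = f P} \<subseteq> fst ` Q" "{A. \<exists>i. (A, i) \<in> Q \<and> c i \<noteq> f P} \<subseteq> fst ` Q"
      by force+
    then have "closed K" "closed L"
      unfolding K_def L_def using fin cl by (auto intro!: closed_Union intro: finite_subset)
    moreover have "K \<inter> L \<inter> C = {}"
    proof -
      have False if Q: "(A, i) \<in> Q" "c i = f P" "R \<in> A" "(B, j) \<in> Q" "c j \<noteq> f P" "R \<in> B"
        and R: "R \<in> C" for A i B j R
        using f[OF Q(1,3)] f[OF Q(4,6)] Q R C(2) by auto
      then show ?thesis unfolding K_def L_def by blast
    qed
    moreover have "C \<subseteq> K \<union> L"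
      unfolding K_def L_def using C(2) by fastforce
    ultimately have "K \<inter> C = {} \<or> L \<inter> C = {}"
      using C(1) by (intro connected_closedD)
    moreover have "P \<in> K"
      using P(1) C(2) f unfolding K_def by fastforce
    moreover have "P' \<in> L"
      using P(2) C(2) f neq unfolding L_def by fastforce
    ultimately show False using P by blast
  qed
qed

text \<open>
  The pieces with their indices give a colouring of the points of the standard diagram off the
  under-points, constant on arcs; the recurrence is the crossing condition. The points of the
  closing arcs at \<open>x = 0\<close> show that \<open>c 0\<close> and \<open>c 1\<close> are both used.
\<close>

lemma mincol_THK3_le:
  fixes c :: "nat \<Rightarrow> int"
  assumes range: "\<And>k. c k \<in> {0..<int r}"
    and rec: "\<And>k. [2 * c (k + 2) - c k - c (k + 3) = 0] (mod int r)"
    and per: "\<And>k. c (k + 2 * n) = c k"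
    and neq: "c 0 \<noteq> c 1"
  shows "mincol r (THK3 n) \<le> enat (card (range c))"
proof -
  let ?D = "THK3 n"
  let ?U = "under_points ?D"
  obtain f where f: "\<And>A i P. (A, i) \<in> indexed_pieces n \<Longrightarrow> P \<in> A \<Longrightarrow> P \<notin> ?U \<Longrightarrow> f P = c i"
    and f_const: "\<And>C P P'. connected C \<Longrightarrow> C \<subseteq> ?D - ?U \<Longrightarrow> P \<in> C \<Longrightarrow> P' \<in> C \<Longrightarrow> f P = f P'"
  proof (rule colouring_from_pieces[of "indexed_pieces n" ?U c])
    show "finite (indexed_pieces n)" by (rule finite_indexed_pieces)
    show "closed A" if "(A, i) \<in> indexed_pieces n" for A i
      using that by (rule closed_indexed_piece)
    show "c i = c j" if "(A, i) \<in> indexed_pieces n" "P \<in> A" "(B, j) \<in> indexed_pieces n" "P \<in> B"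
      "P \<notin> ?U" for A i B j P
      using overlap_index[of c n, OF per that] .
  qed (unfold Union_indexed_pieces, rule that)
  \<comment> \<open>Any point of an arc may represent it, as \<open>f\<close> is constant on arcs.\<close>
  define col where "col A = f (SOME P. P \<in> A)" for A
  have col: "col (arc_at ?D P) = f P" if "P \<in> ?D - ?U" for P
  proof -
    have P: "P \<in> arc_at ?D P"
      using that by (simp add: arc_at_def)
    then have "(SOME P'. P' \<in> arc_at ?D P) \<in> arc_at ?D P"
      by (rule someI)
    then show ?thesis
      unfolding col_def using P
      by (intro f_const[of "arc_at ?D P"])
        (simp_all add: arc_at_def connected_component_subset connected_connected_component)
  qed
  have arcs: "arcs ?D = arc_at ?D ` (?D - ?U)"
    by (auto simp: arcs_def arc_at_def components_def)
  have f_range: "f P \<in> range c" if "P \<in> ?D - ?U" for P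
  proof -
    obtain A i where "(A, i) \<in> indexed_pieces n" "P \<in> A"
      using \<open>P \<in> ?D - ?U\<close> Union_indexed_pieces[of n] by fastforce
    then show ?thesis
      using f that by auto
  qed
  have col_image: "col ` arcs ?D = f ` (?D - ?U)"
    unfolding arcs image_image using col by simp
  then have col_range: "col ` arcs ?D \<subseteq> range c"
    using f_range by auto
  have fin: "finite (range c)"
    using range by (intro finite_subset[of "range c" "{0..<int r}"]) auto
  have "fox_coloring r ?D col"
    unfolding fox_coloring_def
  proof (intro conjI ballI allI impI)
    fix A assume "A \<in> arcs ?D"
    then obtain k where "col A = c k" using col_range by blast
    then show "col A \<in> {0..<int r}" by (simp only: range)
  next
    fix x y assume "crosses_under ?D x y"
    then obtain k where k: "k < 2 * n" and x: "x = under_pt k" and y: "y = over_pt k"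
      by (rule crosses_under_THK3)
    \<comment> \<open>The vector from the crossing point to the end of the under-strand.\<close>
    define v :: point3 where "v = (1/2, - side k / 2, 0)"
    have ends: "x - v = (real k, 2 + side k, 0)" "x + v = (real k + 1, 2, 0)"
      by (simp_all add: x v_def under_pt_def)
    have seg: "closed_segment (x - v) (x + v) = under_piece k"
      unfolding ends under_piece_def flat_strand_def polyline.simps Un_empty_right ..
    have under_unique: "P = x" if P: "P \<in> under_piece k" "P \<in> ?U" for P
    proof -
      obtain l where "P = under_pt l" using P(2) by (auto simp: under_points_THK3)
      moreover from this P(1) have "real k \<le> real l + 1/2" "real l + 1/2 \<le> real k + 1"
        by (simp_all add: under_pt_def mem_under_piece)
      then have "l = k" by linarith
      ultimately show ?thesis by (simp add: x)
    qed
    have pieces: "letter_pieces k \<subseteq> indexed_pieces n"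
      using k by (auto simp: indexed_pieces_def)
    have sub: "under_piece k \<subseteq> ?D" "over_piece k \<subseteq> ?D"
      using k by (auto simp: THK3_eq)
    have mem: "x - v \<in> under_piece k" "x + v \<in> under_piece k"
      unfolding seg[symmetric] by simp_all
    have "v \<noteq> 0" by (simp add: v_def zero_prod_def)
    then have "x - v \<noteq> x" "x + v \<noteq> x" by simp_all
    then have off: "x - v \<notin> ?U" "x + v \<notin> ?U"
      using under_unique[of "x - v"] under_unique[of "x + v"] mem by blast+
    have over: "y \<in> over_piece k" "y \<notin> ?U"
      using pts_in_pieces(2) under_pt_neq_over_pt unfolding y under_points_THK3 by (blast, metis imageE)
    have "f (x - v) = c k"
    proof (rule f[OF _ _ off(1)])
      show "(under_piece k \<inter> {P. fst P \<le> real k + 1/2}, k) \<in> indexed_pieces n"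
        using pieces by (simp add: letter_pieces_def)
      show "x - v \<in> under_piece k \<inter> {P. fst P \<le> real k + 1/2}"
        using mem(1) by (simp add: ends)
    qed
    moreover have "f (x + v) = c (k + 3)"
    proof (rule f[OF _ _ off(2)])
      show "(under_piece k \<inter> {P. fst P \<ge> real k + 1/2}, k + 3) \<in> indexed_pieces n"
        using pieces by (simp add: letter_pieces_def)
      show "x + v \<in> under_piece k \<inter> {P. fst P \<ge> real k + 1/2}"
        using mem(2) by (simp add: ends)
    qed
    moreover have "f y = c (k + 2)"
      using pieces by (intro f[OF _ over]) (simp add: letter_pieces_def)
    ultimately have colors: "col (arc_at ?D (x - v)) = c k" "col (arc_at ?D (x + v)) = c (k + 3)"
      "col (arc_at ?D y) = c (k + 2)"
      using col[of "x - v"] col[of "x + v"] col[of y] sub mem off over by auto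
    show "\<exists>v. v \<noteq> 0 \<and> closed_segment (x - v) (x + v) - {x} \<subseteq> ?D - ?U \<and>
        [2 * col (arc_at ?D y) - col (arc_at ?D (x - v)) - col (arc_at ?D (x + v)) = 0] (mod int r)"
    proof (intro exI conjI)
      show "v \<noteq> 0" by fact
      show "closed_segment (x - v) (x + v) - {x} \<subseteq> ?D - ?U"
        unfolding seg using under_unique sub(1) by blast
      show "[2 * col (arc_at ?D y) - col (arc_at ?D (x - v)) - col (arc_at ?D (x + v)) = 0] (mod int r)"
        unfolding colors by (rule rec)
    qed
  qed
  moreover have "2 \<le> num_colors ?D col"
  proof -
    \<comment> \<open>Under-points have half-integral first coordinates.\<close>
    have not_under: "(0, b, d) \<notin> ?U" for b d
      by (auto simp: under_points_THK3 under_pt_def)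
    have in_closing: "(0, real j, 0) \<in> closing_arc 3 (real (2 * n)) j" if "j \<in> {1..3}" for j
      using that by (subst mem_closing_arc) auto
    have attained: "c (j mod 3) \<in> f ` (?D - ?U)" if j: "j \<in> {1..3}" for j
    proof -
      have "(0, real j, 0) \<in> ?D - ?U"
        using in_closing[OF j] j not_under by (auto simp: THK3_eq)
      moreover have "f (0, real j, 0) = c (j mod 3)"
        using j by (intro f[OF _ in_closing[OF j] not_under]) (auto simp: indexed_pieces_def)
      ultimately show ?thesis by (metis imageI)
    qed
    have "{c 0, c 1} \<subseteq> f ` (?D - ?U)"
      using attained[of 3] attained[of 1] by simp
    then have "card {c 0, c 1} \<le> card (f ` (?D - ?U))"
      using col_range fin finite_subset unfolding col_image by (intro card_mono) auto
    with neq show ?thesis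
      by (simp add: num_colors_def col_image)
  qed
  ultimately have "nontrivial_coloring r ?D col"
    by (simp add: nontrivial_coloring_def)
  moreover have "num_colors ?D col \<le> card (range c)"
    unfolding num_colors_def by (rule card_mono[OF fin col_range])
  ultimately have "diagram_mincol r ?D \<le> enat (card (range c))"
    unfolding diagram_mincol_def by (intro INF_lower2[of col]) auto
  then show ?thesis
    unfolding mincol_def using diagram_of_THK3 by (intro INF_lower2[of ?D]) auto
qed

section \<open>Fibonacci numbers modulo a prime\<close>

lemma turk_u_eq: "turk_u n = int (fib (n + 2)) + (-1) ^ n * int (fib n)"
proof -
  have p: "((-1 + sqrt 5) / 2) ^ n = (-1) ^ n * ((1 - sqrt 5) / 2 :: real) ^ n"
          "((-1 - sqrt 5) / 2) ^ n = (-1) ^ n * ((1 + sqrt 5) / 2 :: real) ^ n"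
    by (simp_all flip: power_mult_distrib add: field_simps)
  have f: "real (fib k) = (((1 + sqrt 5) / 2) ^ k - ((1 - sqrt 5) / 2) ^ k) / sqrt 5" for k
    using fib_closed_form[of k] by simp
  have "real_of_int (turk_u n) = real (fib (n + 2)) + (-1) ^ n * real (fib n)"
    unfolding of_int_turk_u turk_u_real_def p f by (simp add: field_simps)
  also have "\<dots> = of_int (int (fib (n + 2)) + (-1) ^ n * int (fib n))"
    by simp
  finally show ?thesis
    unfolding of_int_eq_iff .
qed

lemma turk_u_odd_index: "odd m \<Longrightarrow> turk_u m = int (fib (Suc m))"
  by (simp add: turk_u_eq)

lemma turk_u_even_index: "even m \<Longrightarrow> turk_u m = int (fib (Suc m)) + 2 * int (fib m)"
  by (simp add: turk_u_eq)

lemma fib_Cassini: "(int (fib (Suc m)) + int (fib m)) * int (fib m) - int (fib (Suc m)) ^ 2 = - ((-1) ^ m)"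
  using fib_Cassini_int[of m] by simp

lemma fib_double: "int (fib (2 * Suc m)) = (int (fib (Suc m)) + 2 * int (fib m)) * int (fib (Suc m))"
  using fib_rec_even[of "Suc m"] by (simp add: algebra_simps)

lemma fib_double_Suc:
  "int (fib (Suc (2 * Suc m))) = (int (fib (Suc m)) + int (fib m)) ^ 2 + int (fib (Suc m)) ^ 2"
  using fib_add[of "Suc m" "Suc m"] by (simp add: power2_eq_square mult_2 flip: of_nat_add of_nat_mult)

text \<open>
  With \<open>a = F\<^sub>n\<close> and \<open>b = F\<^sub>n\<^sub>-\<^sub>1\<close>, where \<open>n = m + 1\<close>, Cassini's identity turns \<open>F\<^sub>2\<^sub>n\<^sub>+\<^sub>1 - 1\<close> into a
  multiple of \<open>a + 2b = L\<^sub>n\<close> or of \<open>a = F\<^sub>n\<close>, according to the parity of \<open>n\<close>.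
\<close>

lemma fib_period:
  assumes "p dvd turk_u m"
  shows "p dvd int (fib (2 * Suc m))" "[int (fib (Suc (2 * Suc m))) = 1] (mod p)"
proof -
  define a b where "a = int (fib (Suc m))" and "b = int (fib m)"
  note C = fib_Cassini[of m, folded a_def b_def]
  have "p dvd (a + 2 * b) * a \<and> p dvd (a + b) ^ 2 + a ^ 2 - 1"
  proof (cases "even m")
    case True
    then have "p dvd a + 2 * b"
      using assms by (simp add: turk_u_even_index a_def b_def)
    moreover have "(a + b) ^ 2 + a ^ 2 - 1 = (a + 2 * b) * (a + b)"
      using C True by (simp add: power2_eq_square algebra_simps)
    ultimately show ?thesis by simp
  next
    case False
    then have "p dvd a"
      using assms by (simp add: turk_u_odd_index a_def)
    moreover have "(a + b) ^ 2 + a ^ 2 - 1 = a * (3 * a + b)"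
      using C False by (simp add: power2_eq_square algebra_simps)
    ultimately show ?thesis by simp
  qed
  then show "p dvd int (fib (2 * Suc m))" "[int (fib (Suc (2 * Suc m))) = 1] (mod p)"
    unfolding fib_double fib_double_Suc by (simp_all add: a_def b_def cong_iff_dvd_diff)
qed

text \<open>
  Sequences of Fibonacci type are determined by two consecutive values, with Fibonacci numbers as
  coefficients. Hence periods of the Fibonacci sequence are periods of all of them.
\<close>

lemma fib_recurrence_shift:
  fixes g :: "nat \<Rightarrow> int"
  assumes "\<And>k. [g (k + 2) = g (k + 1) + g k] (mod p)"
  shows "[g (m + Suc k) = int (fib (Suc k)) * g (Suc m) + int (fib k) * g m] (mod p)"
proof (induction k rule: induct_nat_012)
  case 1
  then show ?case using assms[of m] by simp
next
  case (ge2 k)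
  have "[g (m + Suc (Suc (Suc k))) = g (m + Suc (Suc k)) + g (m + Suc k)] (mod p)"
    using assms[of "m + Suc k"] by simp
  also have "[g (m + Suc (Suc k)) + g (m + Suc k) =
      (int (fib (Suc (Suc k))) * g (Suc m) + int (fib (Suc k)) * g m) +
      (int (fib (Suc k)) * g (Suc m) + int (fib k) * g m)] (mod p)"
    using ge2 by (intro cong_add)
  also have "(int (fib (Suc (Suc k))) * g (Suc m) + int (fib (Suc k)) * g m) +
      (int (fib (Suc k)) * g (Suc m) + int (fib k) * g m) =
      int (fib (Suc (Suc (Suc k)))) * g (Suc m) + int (fib (Suc (Suc k))) * g m"
    by (simp add: algebra_simps)
  finally show ?case .
qed simp

lemma fib_shift:
  assumes "[int (fib m) = 0] (mod p)"
  shows "[int (fib (m + k)) = int (fib (Suc m)) * int (fib k)] (mod p)"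
proof (cases k)
  case 0
  then show ?thesis using assms by simp
next
  case (Suc l)
  have "[int (fib (m + Suc l)) = int (fib (Suc l)) * int (fib (Suc m)) + int (fib l) * int (fib m)] (mod p)"
    by (intro fib_recurrence_shift) simp
  also have "[int (fib (Suc l)) * int (fib (Suc m)) + int (fib l) * int (fib m) =
      int (fib (Suc l)) * int (fib (Suc m)) + int (fib l) * 0] (mod p)"
    using assms by (intro cong_add cong_mult cong_refl)
  finally show ?thesis by (simp add: Suc mult.commute)
qed

text \<open>
  Running the recurrence backwards from a zero at \<open>m\<close> gives the same values as running it forwards,
  up to alternating signs: the step backwards is \<open>F\<^sub>l = F\<^sub>l\<^sub>+\<^sub>2 - F\<^sub>l\<^sub>+\<^sub>1\<close>.
\<close>

lemma fib_reflect:
  assumes "[int (fib m) = 0] (mod p)"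
  shows "k \<le> m \<Longrightarrow> [int (fib (m - k)) = (-1) ^ Suc k * (int (fib (Suc m)) * int (fib k))] (mod p)"
proof (induction k rule: induct_nat_012)
  case 0
  then show ?case using assms by simp
next
  case 1
  then have "int (fib (m - 1)) = int (fib (Suc m)) - int (fib m)"
    by (cases m) auto
  moreover have "[int (fib (Suc m)) - int (fib m) = int (fib (Suc m)) - 0] (mod p)"
    using assms by (intro cong_diff cong_refl)
  ultimately show ?case by simp
next
  case (ge2 k)
  define l where "l = m - Suc (Suc k)"
  have m: "m - Suc k = Suc l" "m - k = Suc (Suc l)" "m - Suc (Suc k) = l"
    using ge2.prems by (auto simp: l_def)
  have "int (fib l) = int (fib (Suc (Suc l))) - int (fib (Suc l))" by simp
  also have "[int (fib (Suc (Suc l))) - int (fib (Suc l)) =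
      (-1) ^ Suc k * (int (fib (Suc m)) * int (fib k)) -
      (-1) ^ Suc (Suc k) * (int (fib (Suc m)) * int (fib (Suc k)))] (mod p)"
    using ge2.IH ge2.prems unfolding m by (intro cong_diff) auto
  also have "(-1) ^ Suc k * (int (fib (Suc m)) * int (fib k)) -
      (-1) ^ Suc (Suc k) * (int (fib (Suc m)) * int (fib (Suc k))) =
      (-1) ^ Suc (Suc (Suc k)) * (int (fib (Suc m)) * int (fib (Suc (Suc k))))"
    by (simp add: algebra_simps)
  finally show ?case unfolding m .
qed

section \<open>Colourings by sequences of Fibonacci type\<close>

text \<open>
  If \<open>F\<close> is a sequence of Fibonacci type, \<open>F\<^sub>k\<^sub>+\<^sub>3 = F\<^sub>k\<^sub>+\<^sub>2 + F\<^sub>k\<^sub>+\<^sub>1 = 2 F\<^sub>k\<^sub>+\<^sub>2 - F\<^sub>k\<close>, which is the crossing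
  condition. Multiplying residues modulo \<open>p\<close> by \<open>r / p\<close> embeds them into those modulo \<open>r\<close>.
\<close>

lemma mincol_le_fib_recurrence:
  fixes g :: "nat \<Rightarrow> int"
  assumes p: "p > 0" "p dvd r" and r: "r > 0" and n: "n > 0" "int p dvd turk_u (n - 1)"
    and rec: "\<And>k. [g (k + 2) = g (k + 1) + g k] (mod int p)"
    and neq: "\<not> [g 0 = g 1] (mod int p)"
  shows "mincol r (THK3 n) \<le> enat (card (range (\<lambda>k. g k mod int p)))"
proof -
  obtain s where s: "r = p * s" using p(2) by blast
  with r have s0: "s > 0" by simp
  define c where "c k = int s * (g k mod int p)" for k
  have "mincol r (THK3 n) \<le> enat (card (range c))"
  proof (rule mincol_THK3_le)
    fix k
    have "int s * (g k mod int p) < int s * int p"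
      using s0 p(1) by (intro mult_strict_left_mono pos_mod_bound) simp_all
    then show "c k \<in> {0..<int r}"
      using p(1) by (simp add: c_def s mult.commute)
    have "[2 * g (k + 2) - g k - g (k + 3) = 2 * g (k + 2) - g k - (g (k + 2) + (g (k + 2) - g k))] (mod int p)"
    proof (intro cong_diff cong_refl)
      have "[g (k + 3) = g (k + 2) + g (k + 1)] (mod int p)"
        using rec[of "k + 1"] by (simp add: numeral_eq_Suc)
      moreover have "[g (k + 2) - g k = g (k + 1)] (mod int p)"
        using cong_diff[OF rec[of k] cong_refl[of "g k"]] by simp
      ultimately show "[g (k + 3) = g (k + 2) + (g (k + 2) - g k)] (mod int p)"
        by (meson cong_add cong_refl cong_sym cong_trans)
    qed
    then have rec3: "[2 * g (k + 2) - g k - g (k + 3) = 0] (mod int p)" by simp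
    have "[2 * (g (k + 2) mod int p) - g k mod int p - g (k + 3) mod int p =
        2 * g (k + 2) - g k - g (k + 3)] (mod int p)"
      by (intro cong_diff cong_mult cong_refl) (simp_all add: cong_def)
    from cong_trans[OF this rec3]
    have "int p dvd 2 * (g (k + 2) mod int p) - g k mod int p - g (k + 3) mod int p"
      by (simp only: cong_0_iff)
    then have "int s * int p dvd int s * (2 * (g (k + 2) mod int p) - g k mod int p - g (k + 3) mod int p)"
      by (intro mult_dvd_mono) simp_all
    then show "[2 * c (k + 2) - c k - c (k + 3) = 0] (mod int r)"
      by (simp add: c_def s cong_0_iff algebra_simps)
    define m where "m = n - 1"
    have nm: "n = Suc m" using n(1) by (simp add: m_def)
    have F: "[int (fib (2 * n)) = 0] (mod int p)" "[int (fib (Suc (2 * n))) = 1] (mod int p)"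
      using fib_period[of "int p" m] n(2) by (simp_all add: nm cong_0_iff)
    obtain l where l: "2 * n = Suc l" using n(1) by (metis not0_implies_Suc mult_eq_0_iff not_gr0 zero_neq_numeral)
    have "[int (fib (Suc (Suc l))) - int (fib (Suc l)) = 1 - 0] (mod int p)"
      using F unfolding l by (intro cong_diff)
    then have Fl: "[int (fib l) = 1] (mod int p)" by simp
    have "[g (k + Suc l) = int (fib (Suc l)) * g (Suc k) + int (fib l) * g k] (mod int p)"
      by (rule fib_recurrence_shift[OF rec])
    also have "[int (fib (Suc l)) * g (Suc k) + int (fib l) * g k = 0 * g (Suc k) + 1 * g k] (mod int p)"
      using F(1) Fl unfolding l by (intro cong_add cong_mult cong_refl)
    finally show "c (k + 2 * n) = c k"
      unfolding l by (simp add: c_def cong_def)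
    show "c 0 \<noteq> c 1"
      using neq s0 by (simp add: c_def cong_def)
  qed
  also have "card (range c) \<le> card (range (\<lambda>k. g k mod int p))"
  proof -
    have "range c = (\<lambda>x. int s * x) ` range (\<lambda>k. g k mod int p)"
      unfolding image_image by (rule image_cong) (simp_all add: c_def)
    moreover have "finite (range (\<lambda>k. g k mod int p))"
    proof (rule finite_subset)
      show "range (\<lambda>k. g k mod int p) \<subseteq> {0..<int p}" using p(1) by auto
    qed simp
    ultimately show ?thesis by (simp only: card_image_le)
  qed
  finally show ?thesis by simp
qed

section \<open>Powers of a golden ratio\<close>

lemma golden_power_recurrence:
  fixes a :: int
  assumes "[a ^ 2 = a + 1] (mod p)"
  shows "[a ^ (k + 2) = a ^ (k + 1) + a ^ k] (mod p)"
  using cong_mult[OF cong_refl[of "a ^ k"] assms]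
  by (simp add: power_add power2_eq_square algebra_simps)

text \<open>
  Put \<open>x = F\<^sub>q\<^sub>-\<^sub>1\<close>. Since \<open>L\<^sub>q\<close> vanishes, \<open>F\<^sub>q = -2x\<close>, and Cassini's identity becomes \<open>5x\<^sup>2 = 1\<close>. So
  \<open>-5x\<close> is a square root of 5 and \<open>a = (1 - 5x) / 2\<close> is a golden ratio. This sign is the right one
  for \<open>a\<^sup>q = F\<^sub>q a + F\<^sub>q\<^sub>-\<^sub>1 = - x (2a - 1) = 5x\<^sup>2 = 1\<close>; the conjugate root has \<open>q\<close>th power -1.
\<close>

lemma exists_golden_root:
  fixes p :: nat
  assumes p: "prime p" "odd p" and q: "odd q" "int p dvd turk_u (q - 1)"
  obtains a :: int where "[a ^ 2 = a + 1] (mod int p)" "[a ^ q = 1] (mod int p)"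
proof -
  define m where "m = q - 1"
  have qm: "q = Suc m" and m: "even m"
    using q(1) by (auto simp: m_def elim: oddE)
  define x y where "x = int (fib m)" and "y = int (fib (Suc m))"
  have dvd: "int p dvd y + 2 * x"
    using q(2) turk_u_even_index[OF m] by (simp only: x_def y_def flip: m_def)
  have x5: "5 * x ^ 2 - 1 = (y + 2 * x) * (3 * x - y)"
    using fib_Cassini[of m, folded x_def y_def] m by (simp add: power2_eq_square algebra_simps)
  have x2: "int p dvd 5 * x ^ 2 - 1" unfolding x5 using dvd by (rule dvd_mult2)
  obtain h where h: "p + 1 = 2 * h" using p(2) by (metis evenE even_plus_one_iff)
  then have h': "2 * int h = int p + 1" by linarith
  \<comment> \<open>\<open>h\<close> is the inverse of 2 modulo \<open>p\<close>.\<close>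
  define a where "a = int h * (1 - 5 * x)"
  have a2: "2 * a - 1 = int p * (1 - 5 * x) - 5 * x"
  proof -
    have "2 * a = (int p + 1) * (1 - 5 * x)"
      unfolding h'[symmetric] a_def by simp
    then show ?thesis by (simp add: algebra_simps)
  qed
  have "int p dvd 4 * (a ^ 2 - (a + 1))"
  proof -
    have "4 * (a ^ 2 - (a + 1)) = (2 * a - 1) ^ 2 - 5"
      by (simp add: power2_eq_square algebra_simps)
    also have "\<dots> = int p * (int p * (1 - 5 * x) ^ 2 - 10 * x * (1 - 5 * x)) + 5 * (5 * x ^ 2 - 1)"
      unfolding a2 by (simp add: power2_eq_square algebra_simps)
    finally have e: "4 * (a ^ 2 - (a + 1)) =
      int p * (int p * (1 - 5 * x) ^ 2 - 10 * x * (1 - 5 * x)) + 5 * (5 * x ^ 2 - 1)" .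
    show ?thesis
      unfolding e by (intro dvd_add dvd_mult2 dvd_mult x2) simp
  qed
  moreover have "coprime (int p) (2 ^ 2)"
    unfolding coprime_power_right_iff using p(2) by simp
  then have "coprime (int p) 4" by simp
  ultimately have "int p dvd a ^ 2 - (a + 1)"
    by (simp only: coprime_dvd_mult_right_iff)
  then have golden: "[a ^ 2 = a + 1] (mod int p)"
    by (simp add: cong_iff_dvd_diff)
  have "[a ^ (k + 2) = a ^ (k + 1) + a ^ k] (mod int p)" for k
    by (rule golden_power_recurrence[OF golden])
  then have "[a ^ (0 + Suc m) = int (fib (Suc m)) * a ^ Suc 0 + int (fib m) * a ^ 0] (mod int p)"
    by (rule fib_recurrence_shift)
  then have "[a ^ q = y * a + x] (mod int p)"
    by (simp add: qm x_def y_def)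
  moreover have "y * a + x - 1 = (y + 2 * x) * a - int p * (x * (1 - 5 * x)) + (5 * x ^ 2 - 1)"
  proof -
    have "y * a + x - 1 = (y + 2 * x) * a - x * (2 * a - 1) - 1" by (simp add: algebra_simps)
    then show ?thesis unfolding a2 by (simp add: power2_eq_square algebra_simps)
  qed
  then have "int p dvd y * a + x - 1"
    using dvd x2 by (metis dvd_add dvd_diff dvd_mult2 dvd_triv_left)
  ultimately have "[a ^ q = 1] (mod int p)"
    by (metis cong_iff_dvd_diff cong_trans)
  with golden that show thesis by blast
qed

text \<open>
  The multiplicative order divides the odd number \<open>q\<close> and the even number \<open>p - 1\<close>, so twice the order
  divides \<open>p - 1\<close>.
\<close>

lemma card_powers_le:
  fixes p :: nat and a :: int
  assumes p: "prime p" "odd p" and q: "odd q" "[a ^ q = 1] (mod int p)"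
  shows "card (range (\<lambda>k. a ^ k mod int p)) \<le> (p - 1) div 2"
proof -
  have p0: "int p > 0" using p(1) prime_gt_0_nat by simp
  define b where "b = nat (a mod int p)"
  have b: "int b = a mod int p"
    using p0 by (simp add: b_def)
  define d where "d = ord p b"
  have ab: "[a ^ k = int (b ^ k)] (mod int p)" for k
    unfolding of_nat_power b by (intro cong_pow) (simp add: cong_def)
  have "[int (b ^ q) = int 1] (mod int p)"
    using cong_trans[OF cong_sym[OF ab] q(2)] by simp
  then have bq: "[b ^ q = 1] (mod p)"
    unfolding cong_int_iff .
  have "coprime b p"
  proof -
    have "\<not> p dvd b"
    proof
      assume "p dvd b"
      moreover have "q > 0" using q(1) by (cases q) auto
      ultimately have "p dvd b ^ q" by (simp add: dvd_power_iff_le dvd_trans[of p b])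
      with bq have "p dvd 1" by (meson cong_dvd_iff)
      with p(1) show False by auto
    qed
    then show ?thesis
      using p(1) by (metis coprime_commute prime_imp_coprime)
  qed
  then have "\<not> p dvd b"
    using p(1) by (metis coprime_absorb_right coprime_commute not_prime_unit)
  then have "d dvd p - 1"
    unfolding d_def using fermat_theorem[OF p(1)] by (simp only: ord_divides[symmetric])
  moreover have dq: "d dvd q"
    unfolding d_def using bq by (simp only: ord_divides)
  then have "odd d" using q(1) by (meson dvd_trans)
  ultimately have "2 * d dvd p - 1"
    using p(2) by (intro divides_mult) auto
  then have "2 * d \<le> p - 1"
    using prime_gt_1_nat[OF p(1)] by (intro dvd_imp_le) auto
  then have "d \<le> (p - 1) div 2" by simp
  moreover have "card (range (\<lambda>k. a ^ k mod int p)) \<le> d"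
  proof -
    have "d > 0" using dq q(1) by (cases d) auto
    have "a ^ k mod int p \<in> (\<lambda>k. a ^ k mod int p) ` {..<d}" for k
    proof -
      have "[b ^ d = 1] (mod p)" unfolding d_def by (rule ord)
      then have "[int (b ^ d) = 1] (mod int p)"
        using cong_int_iff[of "b ^ d" 1 p] by simp
      then have "[a ^ d = 1] (mod int p)" using ab cong_trans by blast
      then have "[(a ^ d) ^ (k div d) * a ^ (k mod d) = 1 ^ (k div d) * a ^ (k mod d)] (mod int p)"
        by (intro cong_mult cong_pow cong_refl)
      then have "[a ^ k = a ^ (k mod d)] (mod int p)"
        by (simp flip: power_mult power_add)
      moreover have "k mod d < d" using \<open>d > 0\<close> by simp
      ultimately show ?thesis by (auto simp: cong_def)
    qed
    then have "card (range (\<lambda>k. a ^ k mod int p)) \<le> card ((\<lambda>k. a ^ k mod int p) ` {..<d})"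
      by (intro card_mono) auto
    also have "\<dots> \<le> d"
      using card_image_le[of "{..<d}"] by simp
    finally show ?thesis .
  qed
  ultimately show ?thesis by simp
qed

section \<open>Residues of Fibonacci numbers\<close>

text \<open>
  Shifting by \<open>m\<close> and reflecting at \<open>m\<close> reduce every index to one of at most \<open>m / 2\<close>, at the cost of a
  power of \<open>w = F\<^sub>m\<^sub>+\<^sub>1\<close>; the sign in the reflection is such a power by the assumption on \<open>e\<close>. The
  value \<open>F\<^sub>0 = 0\<close> counts once, and \<open>F\<^sub>1 = F\<^sub>2\<close> makes the index 1 superfluous.
\<close>

lemma card_fib_residues_le:
  fixes p :: nat
  assumes m: "[int (fib m) = 0] (mod int p)" "4 \<le> m"
    and N: "[int (fib (Suc m)) ^ N = 1] (mod int p)" "0 < N"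
    and e: "[int (fib (Suc m)) ^ e = -1] (mod int p)"
  shows "card (range (\<lambda>k. int (fib k) mod int p)) \<le> 1 + N * (m div 2 - 1)"
proof -
  define w where "w = int (fib (Suc m))"
  note w = w_def[symmetric]
  have reduce: "\<exists>j i. i \<le> m div 2 \<and> [int (fib k) = w ^ j * int (fib i)] (mod int p)" for k
  proof (induction k rule: less_induct)
    case (less k)
    consider "k \<le> m div 2" | "m div 2 < k" "k < m" | "m \<le> k" by linarith
    then show ?case
    proof cases
      case 1
      then show ?thesis by (intro exI[of _ 0] exI[of _ k]) simp
    next
      case 2
      have "[int (fib (m - (m - k))) = (-1) ^ Suc (m - k) * (w * int (fib (m - k)))] (mod int p)"
        unfolding w_def using fib_reflect[OF m(1)] by simp
      moreover have "[(w ^ e) ^ Suc (m - k) * (w * int (fib (m - k))) =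
          (-1) ^ Suc (m - k) * (w * int (fib (m - k)))] (mod int p)"
        using e[folded w_def] by (intro cong_mult cong_pow cong_refl)
      ultimately have "[int (fib k) = (w ^ e) ^ Suc (m - k) * (w * int (fib (m - k)))] (mod int p)"
        using 2 cong_trans cong_sym by (metis diff_diff_cancel less_imp_le)
      also have "(w ^ e) ^ Suc (m - k) * (w * int (fib (m - k))) =
          w ^ (e * Suc (m - k) + 1) * int (fib (m - k))"
        by (simp only: power_add power_mult power_one_right mult.assoc)
      finally show ?thesis
        using 2 by (intro exI[of _ "e * Suc (m - k) + 1"] exI[of _ "m - k"]) linarith
    next
      case 3
      then obtain i j where i: "i \<le> m div 2" and "[int (fib (k - m)) = w ^ j * int (fib i)] (mod int p)"
        using less.IH[of "k - m"] m(2) by auto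
      then have "[w * int (fib (k - m)) = w * (w ^ j * int (fib i))] (mod int p)"
        by (intro cong_mult cong_refl)
      moreover have "[int (fib k) = w * int (fib (k - m))] (mod int p)"
        using fib_shift[OF m(1), of "k - m"] 3 by (simp add: w_def)
      ultimately have "[int (fib k) = w ^ Suc j * int (fib i)] (mod int p)"
        using cong_trans by (simp add: mult.assoc) blast
      with i show ?thesis by blast
    qed
  qed
  define X where "X = insert 0 ((\<lambda>(j, i). w ^ j * int (fib i) mod int p) ` ({..<N} \<times> {2..m div 2}))"
  have "int (fib k) mod int p \<in> X" for k
  proof -
    obtain i j where i: "i \<le> m div 2" and j: "[int (fib k) = w ^ j * int (fib i)] (mod int p)"
      using reduce by blast
    have "[(w ^ N) ^ (j div N) * w ^ (j mod N) * int (fib i) =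
        1 ^ (j div N) * w ^ (j mod N) * int (fib i)] (mod int p)"
      using N(1)[folded w_def] by (intro cong_mult cong_pow cong_refl)
    then have "[w ^ j * int (fib i) = w ^ (j mod N) * int (fib i)] (mod int p)"
      by (simp flip: power_mult power_add)
    with j have k: "int (fib k) mod int p = w ^ (j mod N) * int (fib i) mod int p"
      unfolding cong_def by simp
    have jN: "j mod N < N" using N(2) by simp
    \<comment> \<open>\<open>F\<^sub>1 = F\<^sub>2\<close>\<close>
    define i' where "i' = (if i = 1 then 2 else i)"
    have "fib i = fib i'" by (simp add: i'_def)
    moreover have "i' \<le> m div 2" "i' = 0 \<or> 2 \<le> i'"
      using i m(2) by (auto simp: i'_def)
    ultimately show ?thesis
      unfolding X_def k using jN by (force simp: image_iff)
  qed
  then have "card (range (\<lambda>k. int (fib k) mod int p)) \<le> card X"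
    by (intro card_mono) (auto simp: X_def)
  also have "card X \<le> Suc (card ((\<lambda>(j, i). w ^ j * int (fib i) mod int p) ` ({..<N} \<times> {2..m div 2})))"
    unfolding X_def by (rule card_insert_le_m1) auto
  also have "\<dots> \<le> Suc (card ({..<N} \<times> {2..m div 2}))"
    by (intro Suc_leI le_imp_less_Suc card_image_le) auto
  also have "\<dots> = 1 + N * (m div 2 - 1)"
    by (simp add: card_cartesian_product)
  finally show ?thesis .
qed

section \<open>Bounds for the number of colours\<close>

lemma mincol_THK3_odd_rank:
  fixes p :: nat
  assumes p: "prime p" "odd p" "p dvd r" and r: "r > 0" and n: "n > 0" "int p dvd turk_u (n - 1)"
    and q: "odd q" "int p dvd turk_u (q - 1)"
  shows "mincol r (THK3 n) \<le> enat ((p - 1) div 2)"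
proof -
  have p1: "1 < p" using p(1) by (rule prime_gt_1_nat)
  obtain a where golden: "[a ^ 2 = a + 1] (mod int p)" and aq: "[a ^ q = 1] (mod int p)"
    using exists_golden_root[OF p(1,2) q] .
  have "mincol r (THK3 n) \<le> enat (card (range (\<lambda>k. a ^ k mod int p)))"
  proof (rule mincol_le_fib_recurrence[OF _ p(3) r n])
    show "p > 0" using p1 by simp
    show "[a ^ (k + 2) = a ^ (k + 1) + a ^ k] (mod int p)" for k
      by (rule golden_power_recurrence[OF golden])
    show "\<not> [a ^ 0 = a ^ 1] (mod int p)"
    proof
      assume "[a ^ 0 = a ^ 1] (mod int p)"
      then have a1: "[a = 1] (mod int p)" by (simp add: cong_sym_eq)
      have "[1 ^ 2 = a ^ 2] (mod int p)"
        using a1 by (intro cong_pow) (rule cong_sym)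
      also note golden
      also have "[a + 1 = 1 + 1] (mod int p)"
        using a1 by (intro cong_add cong_refl)
      finally have "int p dvd 1"
        by (simp add: cong_iff_dvd_diff)
      with p1 show False by simp
    qed
  qed
  also have "enat (card (range (\<lambda>k. a ^ k mod int p))) \<le> enat ((p - 1) div 2)"
    using card_powers_le[OF p(1,2) q(1) aq] by simp
  finally show ?thesis .
qed

lemma mincol_le_fib_residues:
  fixes p :: nat
  assumes p: "1 < p" "p dvd r" and r: "r > 0" and n: "n > 0" "int p dvd turk_u (n - 1)"
    and card: "card (range (\<lambda>k. int (fib k) mod int p)) \<le> b"
  shows "mincol r (THK3 n) \<le> enat b"
proof -
  have "mincol r (THK3 n) \<le> enat (card (range (\<lambda>k. int (fib k) mod int p)))"
  proof (rule mincol_le_fib_recurrence[OF _ p(2) r n])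
    show "p > 0" using p(1) by simp
    show "[int (fib (k + 2)) = int (fib (k + 1)) + int (fib k)] (mod int p)" for k
      by simp
    show "\<not> [int (fib 0) = int (fib 1)] (mod int p)"
      using p(1) by (simp add: cong_def)
  qed
  also have "\<dots> \<le> enat b" using card by simp
  finally show ?thesis .
qed

text \<open>
  Since \<open>q\<close> is minimal and \<open>q / 2\<close> is even, \<open>p\<close> does not divide \<open>F\<^sub>q\<^sub>/\<^sub>2\<close>, so it divides the other factor
  \<open>L\<^sub>q\<^sub>/\<^sub>2\<close> of \<open>F\<^sub>q\<close>. By Cassini's identity, \<open>F\<^sub>q\<^sub>+\<^sub>1 + 1\<close> is a multiple of it.
\<close>

lemma card_fib_residues_rank_4_dvd:
  assumes p: "prime p" and q: "q > 0" "4 dvd q" "int p dvd turk_u (q - 1)"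
    and least: "\<And>h. 0 < h \<Longrightarrow> h < q \<Longrightarrow> \<not> int p dvd turk_u (h - 1)"
  shows "card (range (\<lambda>k. int (fib k) mod int p)) \<le> q - 1"
proof -
  obtain t where t: "q = 4 * t" using q(2) by blast
  with q(1) have t0: "t > 0" by simp
  define m where "m = 2 * t - 1"
  have qm: "q = 2 * Suc m" and m: "odd m" using t t0 by (auto simp: m_def)
  define a b where "a = int (fib (Suc m))" and "b = int (fib m)"
  have "odd (q - 1)" "Suc (q - 1) = q" using qm by auto
  then have "int p dvd int (fib q)"
    using q(3) turk_u_odd_index[of "q - 1"] by simp
  then have "int p dvd (a + 2 * b) * a"
    unfolding qm fib_double a_def b_def .
  moreover have "\<not> int p dvd a"
    using least[of "Suc m"] qm turk_u_odd_index[OF m] by (simp add: a_def)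
  ultimately have dvd: "int p dvd a + 2 * b"
    using p by (simp add: prime_dvd_mult_iff)
  have "int (fib (Suc q)) - -1 = (a + b) ^ 2 + a ^ 2 + 1"
    unfolding qm fib_double_Suc a_def b_def by simp
  also have "\<dots> = (a + 2 * b) * (a + b)"
    using fib_Cassini[of m, folded a_def b_def] m by (simp add: power2_eq_square algebra_simps)
  finally have "int p dvd int (fib (Suc q)) - -1" using dvd by simp
  then have Fq: "[int (fib (Suc q)) = -1] (mod int p)"
    by (simp only: cong_iff_dvd_diff)
  have "card (range (\<lambda>k. int (fib k) mod int p)) \<le> 1 + 2 * (q div 2 - 1)"
  proof (rule card_fib_residues_le)
    show "[int (fib q) = 0] (mod int p)"
      using \<open>int p dvd int (fib q)\<close> by (simp only: cong_0_iff)
    show "4 \<le> q" using t t0 by simp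
    show "[int (fib (Suc q)) ^ 2 = 1] (mod int p)"
      using cong_pow[OF Fq, of 2] by simp
    show "[int (fib (Suc q)) ^ 1 = -1] (mod int p)"
      using Fq by simp
  qed simp
  also have "\<dots> = q - 1" using t t0 by simp
  finally show ?thesis .
qed

text \<open>
  Since \<open>q\<close> is minimal and \<open>h = q / 2\<close> is odd, \<open>p\<close> does not divide \<open>L\<^sub>h\<close>, so it divides \<open>F\<^sub>h\<close>. By
  Cassini's identity, \<open>F\<^sub>h\<^sub>+\<^sub>1\<close> is then a square root of -1. As \<open>F\<^sub>1 = 1\<close> and \<open>F\<^sub>3 = 2\<close> are not divisible
  by \<open>p\<close>, it follows that \<open>h \<ge> 5\<close>.
\<close>

lemma card_fib_residues_rank_2_mod_4:
  assumes p: "prime p" "p > 5" and q: "even q" "\<not> 4 dvd q" "int p dvd turk_u (q - 1)"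
    and least: "\<And>h. 0 < h \<Longrightarrow> h < q \<Longrightarrow> \<not> int p dvd turk_u (h - 1)"
  shows "card (range (\<lambda>k. int (fib k) mod int p)) \<le> q - 5"
proof -
  obtain h where h: "q = 2 * h" using q(1) by blast
  have "odd h"
  proof
    assume "even h"
    then obtain t where "h = 2 * t" ..
    with h q(2) show False by simp
  qed
  then obtain m where hm: "h = Suc m" and m: "even m" by (cases h) auto
  define a b where "a = int (fib (Suc m))" and "b = int (fib m)"
  have qm: "q = 2 * Suc m" using h hm by simp
  have "odd (q - 1)" "Suc (q - 1) = q" using qm by auto
  then have "int p dvd int (fib q)"
    using q(3) turk_u_odd_index[of "q - 1"] by simp
  then have "int p dvd (a + 2 * b) * a"
    unfolding qm fib_double a_def b_def .
  moreover have "\<not> int p dvd a + 2 * b"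
    using least[of "Suc m"] qm turk_u_even_index[OF m] by (simp add: a_def b_def)
  ultimately have dvd: "int p dvd a"
    using p(1) by (simp add: prime_dvd_mult_iff)
  have "\<not> p dvd 1" "\<not> p dvd 2"
    using p(2) by (auto dest!: dvd_imp_le)
  moreover have "p dvd fib (Suc m)" using dvd by (simp add: a_def)
  moreover have "fib (Suc 0) = 1" "fib (Suc 2) = 2" by (simp_all add: numeral_eq_Suc)
  ultimately have "m \<noteq> 0" "m \<noteq> 2" by metis+
  with m have m4: "4 \<le> m" by presburger
  have "int (fib (Suc h)) ^ 2 - -1 = (a + b) ^ 2 + 1"
    by (simp add: hm a_def b_def)
  also have "\<dots> = a * (2 * a + b)"
    using fib_Cassini[of m, folded a_def b_def] m by (simp add: power2_eq_square algebra_simps)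
  finally have "int p dvd int (fib (Suc h)) ^ 2 - -1" using dvd by simp
  then have Fh: "[int (fib (Suc h)) ^ 2 = -1] (mod int p)"
    by (simp only: cong_iff_dvd_diff)
  have "card (range (\<lambda>k. int (fib k) mod int p)) \<le> 1 + 4 * (h div 2 - 1)"
  proof (rule card_fib_residues_le)
    show "[int (fib h) = 0] (mod int p)"
      using dvd by (simp only: cong_0_iff a_def hm)
    show "4 \<le> h" using m4 hm by simp
    show "[int (fib (Suc h)) ^ 4 = 1] (mod int p)"
      using cong_pow[OF Fh, of 2] by (simp flip: power_mult)
    show "[int (fib (Suc h)) ^ 2 = -1] (mod int p)"
      by (rule Fh)
  qed simp
  also have "\<dots> = q - 5" using m m4 by (auto simp: qm hm elim!: evenE)
  finally show ?thesis .
qed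

lemma psi_factor_common_prime:
  assumes "\<exists>q. common_prime a r q"
  shows "common_prime a r (psi_factor a r)"
proof -
  have "\<exists>q. is_arg_min psi (common_prime a r) q"
    using ex_has_least_nat[of "common_prime a r" _ psi] assms
    by (metis is_arg_min_linorder)
  then have "is_arg_min psi (common_prime a r) (psi_factor a r)"
    unfolding psi_factor_def by (rule LeastI_ex)
  then show ?thesis by (simp add: is_arg_min_def)
qed

theorem corollary1p3:
  fixes n r p :: nat
  assumes "n > 0" and "r > 0"
    and "gcd (turk_u (n - 1)) (int r) > 1"
    and "\<exists>q. common_prime (turk_u (n - 1)) r q"
    and "p = psi_factor (turk_u (n - 1)) r"
  shows "(odd (psi p) \<longrightarrow>
            ([5 ^ ((p - 1) div 2) = -1] (mod int p) \<longrightarrow>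
               mincol r (THK3 n) \<le> enat ((p + 1) div 2)) \<and>
            ([5 ^ ((p - 1) div 2) = 1] (mod int p) \<longrightarrow>
               mincol r (THK3 n) \<le> enat ((p - 1) div 2))) \<and>
         (even (psi p) \<longrightarrow>
            (4 dvd psi p \<longrightarrow> mincol r (THK3 n) \<le> enat (psi p - 1)) \<and>
            (\<not> 4 dvd psi p \<longrightarrow> mincol r (THK3 n) \<le> enat (psi p - 5)))"
proof -
  have "common_prime (turk_u (n - 1)) r p"
    using psi_factor_common_prime[OF assms(4)] assms(5) by simp
  then have p: "prime p" "p > 5" "p dvd r" and u: "int p dvd turk_u (n - 1)"
    by (simp_all add: common_prime_def)
  have odd: "odd p" using p prime_odd_nat by simp
  have "0 < n \<and> int p dvd turk_u (n - 1)"
    using assms(1) u by simp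
  then have "0 < psi p \<and> int p dvd turk_u (psi p - 1)"
    unfolding psi_def by (rule LeastI)
  then have psi: "0 < psi p" "int p dvd turk_u (psi p - 1)" by simp_all
  have least: "\<not> int p dvd turk_u (h - 1)" if "0 < h" "h < psi p" for h
    using not_less_Least[of h "\<lambda>q. 0 < q \<and> int p dvd turk_u (q - 1)"] that
    unfolding psi_def by simp
  have half: "mincol r (THK3 n) \<le> enat ((p - 1) div 2)" if "odd (psi p)"
    using mincol_THK3_odd_rank[OF p(1) odd p(3) assms(2,1) u that psi(2)] .
  have "enat ((p - 1) div 2) \<le> enat ((p + 1) div 2)" by simp
  with half have "mincol r (THK3 n) \<le> enat ((p + 1) div 2)" if "odd (psi p)"
    using that order_trans by blast
  moreover have "mincol r (THK3 n) \<le> enat (psi p - 1)" if "4 dvd psi p"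
    using mincol_le_fib_residues[OF _ p(3) assms(2,1) u
        card_fib_residues_rank_4_dvd[OF p(1) psi(1) that psi(2) least]] p(2) by simp
  moreover have "mincol r (THK3 n) \<le> enat (psi p - 5)" if "even (psi p)" "\<not> 4 dvd psi p"
    using mincol_le_fib_residues[OF _ p(3) assms(2,1) u
        card_fib_residues_rank_2_mod_4[OF p(1,2) that psi(2) least]] p(2) by simp
  ultimately show ?thesis using half by blast
qed

end
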